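(* Let $q$ be a prime power and $r \in (0,1)$ (with $rq$ an integer). Then any Boolean circuit of depth $h$ built from (unbounded fan-in) $\land$, $\lor$, $\lnot$ and $\oplus$ gates that computes $\text{AP}_r$ on $q^2$ input bits must have size at least $\exp\left(\tilde{\Omega}\left(h\, q^{\frac{r^2}{h-1}}\right)\right)$.
   Context: Let $\mathbb{F}_q=\{a_1,\ldots,a_q\}$ be the finite field with $q$ elements. Andreev's Problem with parameter $r$ is the Boolean function $\text{AP}_r:\{0,1\}^{q\times q}\to\{0,1\}$ defined as follows: identify $\mathbb{F}_q^2$ with the $q^2$ input coordinates, so an input is the indicator vector of a set $S\subseteq \mathbb{F}_q^2$; then $\text{AP}_r(S)=1$ if and only if there is a univariate polynomial $P$ over $\mathbb{F}_q$ of degree at most $rq$ such that $(a_i,P(a_i))\in S$ for every $i\in[q]$. The $\tilde{\Omega}$ hides polylogarithmic factors. *)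

theory Defs
  imports
    Complex_Main
    "HOL-Algebra.Polynomials"
    "HOL-Number_Theory.Prime_Powers"
begin

text \<open>
  Circuits are DAGs, presented in topological order: \<open>Gate j\<close> denotes the output of the \<open>j\<close>-th
  entry of the list of gates, which may be used any number of times by later gates. Fan-in is
  unbounded, parallel wires are allowed, and a conjunction (disjunction) of no wires is the
  constant 1 (0).
\<close>

datatype 'v wire = Input 'v | Gate nat

datatype 'v gate =
    And "'v wire list"
  | Or "'v wire list"
  | Xor "'v wire list"
  | Not "'v wire"

datatype 'v circuit = Circuit (gates: "'v gate list") (output_wire: "'v wire")

primrec gate_inputs :: "'v gate \<Rightarrow> 'v wire set" where
  "gate_inputs (And ws) = set ws"
| "gate_inputs (Or ws) = set ws"
| "gate_inputs (Xor ws) = set ws"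
| "gate_inputs (Not w) = {w}"

definition wires_available :: "'v set \<Rightarrow> nat \<Rightarrow> 'v wire set" where
  "wires_available V n = Input ` V \<union> Gate ` {..<n}"

definition circuit_over :: "'v set \<Rightarrow> 'v circuit \<Rightarrow> bool" where
  "circuit_over V C \<longleftrightarrow>
     (\<forall>i < length (gates C). gate_inputs (gates C ! i) \<subseteq> wires_available V i) \<and>
     output_wire C \<in> wires_available V (length (gates C))"

primrec wire_val :: "('v \<Rightarrow> bool) \<Rightarrow> bool list \<Rightarrow> 'v wire \<Rightarrow> bool" where
  "wire_val x vs (Input v) = x v"
| "wire_val x vs (Gate j) = vs ! j"

primrec gate_val :: "('v \<Rightarrow> bool) \<Rightarrow> bool list \<Rightarrow> 'v gate \<Rightarrow> bool" where
  "gate_val x vs (And ws) = (\<forall>w \<in> set ws. wire_val x vs w)"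
| "gate_val x vs (Or ws) = (\<exists>w \<in> set ws. wire_val x vs w)"
| "gate_val x vs (Xor ws) = odd (length (filter (wire_val x vs) ws))"
| "gate_val x vs (Not w) = (\<not> wire_val x vs w)"

definition circuit_val :: "'v circuit \<Rightarrow> ('v \<Rightarrow> bool) \<Rightarrow> bool" where
  "circuit_val C x =
     wire_val x (foldl (\<lambda>vs g. vs @ [gate_val x vs g]) [] (gates C)) (output_wire C)"

primrec wire_depth :: "nat list \<Rightarrow> 'v wire \<Rightarrow> nat" where
  "wire_depth ds (Input v) = 0"
| "wire_depth ds (Gate j) = ds ! j"

definition gate_depth :: "nat list \<Rightarrow> 'v gate \<Rightarrow> nat" where
  "gate_depth ds g = Suc (Max (insert 0 (wire_depth ds ` gate_inputs g)))"

text \<open>The maximal number of gates (negations included) on a path from an input to the output.\<close>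

definition circuit_depth :: "'v circuit \<Rightarrow> nat" where
  "circuit_depth C =
     wire_depth (foldl (\<lambda>ds g. ds @ [gate_depth ds g]) [] (gates C)) (output_wire C)"

definition circuit_size :: "'v circuit \<Rightarrow> nat" where
  "circuit_size C = length (gates C)"

text \<open>A circuit on the input bits \<open>V\<close> computes a predicate \<open>f\<close> on subsets of \<open>V\<close>, each subset
  being fed in as its indicator vector.\<close>

definition computes :: "'v circuit \<Rightarrow> 'v set \<Rightarrow> ('v set \<Rightarrow> bool) \<Rightarrow> bool" where
  "computes C V f \<longleftrightarrow>
     circuit_over V C \<and> (\<forall>S \<subseteq> V. circuit_val C (\<lambda>v. v \<in> S) \<longleftrightarrow> f S)"

definition andreev :: "'a ring \<Rightarrow> real \<Rightarrow> ('a \<times> 'a) set \<Rightarrow> bool" where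
  "andreev F r S \<longleftrightarrow>
     (\<exists>P. polynomial\<^bsub>F\<^esub> (carrier F) P \<and> real (degree P) \<le> r * real (order F) \<and>
          (\<forall>a \<in> carrier F. (a, ring.eval F P a) \<in> S))"

end

theory Submission
  imports
    Defs
    "HOL-Algebra.Polynomial_Divisibility"
    "HOL-Real_Asymp.Real_Asymp"
begin

text \<open>
  Write \<open>d = r q\<close>. Forcing the value 0 on \<open>d + 1 - k\<close> columns and freeing others turns the problem
  into: does the random set \<open>S\<close> contain a word of a code of length \<open>n\<close> and dimension \<open>k\<close>, any
  \<open>k\<close> coordinates of a word being free? Choose \<open>k\<close> of order \<open>q / log q\<close> with \<open>q\<^sup>k \<approx> 2\<^sup>n\<close> and
  \<open>n\<close> a small multiple of \<open>q\<close>. If every point lies in \<open>S\<close> with probability \<open>p\<close>, the first moment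
  shows that mostly no word survives when \<open>p \<le> (1 - 40/n)/2\<close>, and the second moment, whose ratio
  is about \<open>exp (n/q)\<close>, that mostly some word survives when \<open>p \<ge> (1 + 40/n)/2\<close>.

  Connecting each input bit to a random coordinate of \<open>x \<in> {0,1}\<^sup>2\<^sup>m\<close>, with \<open>m\<close> a small multiple of
  \<open>n\<^sup>2\<close>, makes \<open>p = |x| / 2m\<close>, and \<open>|x|\<close> is rarely within the window. So a circuit for the
  problem becomes one for the majority of \<open>2m\<close> bits that is correct on most inputs, and the method
  of Razborov and Smolensky gives size \<open>exp (\<Omega> (m\<^bsup>1/(2(h-1))\<^esup>)) = exp (\<Omega> (q\<^bsup>1/(h-1)\<^esup>))\<close>,
  more than claimed since \<open>r\<^sup>2 \<le> \<rho>\<^sup>2 < 1\<close>. If \<open>d + 1 < k\<close>, then \<open>q\<^bsup>r\<^sup>2\<^esup>\<close> is bounded and it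
  suffices that no single gate computes the function.
\<close>

section \<open>Polynomials over the field with two elements\<close>

text \<open>A 0/1 vector is a subset \<open>x\<close> of \<open>U\<close>. On polynomials over the field with two elements,
  viewed as predicates on \<open>x\<close>, addition is \<open>\<noteq>\<close> and the monomial with variables \<open>T\<close> is \<open>T \<subseteq> x\<close>.\<close>

inductive f2_degree_le :: "'b set \<Rightarrow> nat \<Rightarrow> ('b set \<Rightarrow> bool) \<Rightarrow> bool" for U d where
  f2_zero: "f2_degree_le U d (\<lambda>_. False)"
| f2_add_monom: "T \<subseteq> U \<Longrightarrow> card T \<le> d \<Longrightarrow> f2_degree_le U d f \<Longrightarrow>
    f2_degree_le U d (\<lambda>x. (T \<subseteq> x) \<noteq> f x)"

lemma f2_monom: "T \<subseteq> U \<Longrightarrow> card T \<le> d \<Longrightarrow> f2_degree_le U d (\<lambda>x. T \<subseteq> x)"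
  using f2_add_monom[OF _ _ f2_zero] by simp

lemma f2_one: "f2_degree_le U d (\<lambda>_. True)"
  using f2_monom[of "{}" U d] by simp

lemma f2_const: "f2_degree_le U d (\<lambda>_. b)"
  by (cases b) (simp_all add: f2_one f2_zero)

lemma f2_mono: "f2_degree_le U d f \<Longrightarrow> d \<le> e \<Longrightarrow> f2_degree_le U e f"
  by (induction rule: f2_degree_le.induct) (blast intro: f2_zero f2_add_monom le_trans)+

lemma f2_add:
  assumes "f2_degree_le U d f" "f2_degree_le U d g"
  shows "f2_degree_le U d (\<lambda>x. f x \<noteq> g x)"
  using assms(1)
proof (induction rule: f2_degree_le.induct)
  case f2_zero
  then show ?case using assms(2) by simp
next
  case (f2_add_monom T f)
  have "(\<lambda>x. ((T \<subseteq> x) \<noteq> f x) \<noteq> g x) = (\<lambda>x. (T \<subseteq> x) \<noteq> (f x \<noteq> g x))" by auto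
  then show ?case
    using f2_degree_le.f2_add_monom[OF f2_add_monom.hyps(1,2) f2_add_monom.IH] by simp
qed

lemma f2_not: "f2_degree_le U d f \<Longrightarrow> f2_degree_le U d (\<lambda>x. \<not> f x)"
  using f2_add[OF f2_one] by simp

text \<open>Squares of 0/1 variables reduce to the variables themselves, so two monomials multiply
  to the monomial of \<open>T \<union> S\<close>, and degrees add by the bound on the size of a
  union.\<close>

lemma f2_mult:
  assumes "f2_degree_le U d f" "f2_degree_le U e g"
  shows "f2_degree_le U (d + e) (\<lambda>x. f x \<and> g x)"
proof -
  have monom: "f2_degree_le U (d + e) (\<lambda>x. T \<subseteq> x \<and> g x)" if T: "T \<subseteq> U" "card T \<le> d" for T
    using assms(2)
  proof (induction rule: f2_degree_le.induct)
    case f2_zero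
    then show ?case using f2_degree_le.f2_zero by simp
  next
    case (f2_add_monom S g)
    have "(\<lambda>x. T \<subseteq> x \<and> (S \<subseteq> x) \<noteq> g x) = (\<lambda>x. (T \<union> S \<subseteq> x) \<noteq> (T \<subseteq> x \<and> g x))" by auto
    moreover have "card (T \<union> S) \<le> d + e"
      using card_Un_le[of T S] T(2) f2_add_monom.hyps(2) by linarith
    ultimately show ?case
      using f2_degree_le.f2_add_monom[OF _ _ f2_add_monom.IH, of "T \<union> S"]
        T(1) f2_add_monom.hyps(1) by simp
  qed
  show ?thesis
    using assms(1)
  proof (induction rule: f2_degree_le.induct)
    case f2_zero
    then show ?case using f2_degree_le.f2_zero by simp
  next
    case (f2_add_monom T f)
    have "(\<lambda>x. ((T \<subseteq> x) \<noteq> f x) \<and> g x) = (\<lambda>x. (T \<subseteq> x \<and> g x) \<noteq> (f x \<and> g x))" by auto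
    then show ?case
      using f2_add[OF monom[OF f2_add_monom.hyps(1,2)] f2_add_monom.IH] by simp
  qed
qed

lemma f2_or:
  assumes "f2_degree_le U d f" "f2_degree_le U e g"
  shows "f2_degree_le U (d + e) (\<lambda>x. f x \<or> g x)"
  using f2_not[OF f2_mult[OF f2_not[OF assms(1)] f2_not[OF assms(2)]]] by simp

lemma f2_parity_list:
  assumes "\<And>w. w \<in> set ws \<Longrightarrow> f2_degree_le U d (P w)"
  shows "f2_degree_le U d (\<lambda>x. odd (length (filter (\<lambda>w. P w x) ws)))"
  using assms
proof (induction ws)
  case Nil
  then show ?case using f2_zero by simp
next
  case (Cons w ws)
  have "(\<lambda>x. odd (length (filter (\<lambda>w. P w x) (w # ws)))) =
      (\<lambda>x. P w x \<noteq> odd (length (filter (\<lambda>w. P w x) ws)))" by auto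
  moreover have "f2_degree_le U d (\<lambda>x. P w x \<noteq> odd (length (filter (\<lambda>w. P w x) ws)))"
    using Cons by (intro f2_add) simp_all
  ultimately show ?case by (simp only:)
qed

text \<open>The predicate is the product of \<open>card T\<close> linear factors, each of them 1
  plus a variable.\<close>

lemma f2_avoid:
  assumes "finite T" "T \<subseteq> U"
  shows "f2_degree_le U (card T) (\<lambda>x. T \<inter> x = {})"
  using assms
proof (induction T rule: finite_induct)
  case empty
  then show ?case using f2_one by simp
next
  case (insert a T)
  have "f2_degree_le U 1 (\<lambda>x. \<not> {a} \<subseteq> x)"
    using insert.prems by (intro f2_not f2_monom) auto
  from f2_mult[OF this insert.IH] insert.prems insert.hyps
  have "f2_degree_le U (card (insert a T)) (\<lambda>x. \<not> {a} \<subseteq> x \<and> T \<inter> x = {})" by simp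
  moreover have "(\<lambda>x. insert a T \<inter> x = {}) = (\<lambda>x. \<not> {a} \<subseteq> x \<and> T \<inter> x = {})" by auto
  ultimately show ?case by simp
qed

text \<open>Replacing each variable by 1 plus that variable turns a monomial into a product of
  equally many linear factors, so the degree does not rise.\<close>

lemma f2_complement:
  assumes "finite U" "f2_degree_le U d f"
  shows "f2_degree_le U d (\<lambda>x. f (U - x))"
  using assms(2)
proof (induction rule: f2_degree_le.induct)
  case f2_zero
  then show ?case by (rule f2_degree_le.f2_zero)
next
  case (f2_add_monom T f)
  have "f2_degree_le U d (\<lambda>x. T \<inter> x = {})"
    using f2_avoid[of T U] f2_mono[OF _ f2_add_monom.hyps(2)] f2_add_monom.hyps(1)
      finite_subset[OF _ assms(1)] by auto
  moreover have "(\<lambda>x. (T \<subseteq> U - x) \<noteq> f (U - x)) = (\<lambda>x. (T \<inter> x = {}) \<noteq> f (U - x))"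
    using f2_add_monom.hyps(1) by (intro ext) auto
  ultimately show ?case using f2_add[OF _ f2_add_monom.IH] by simp
qed

section \<open>Interpolation on layers of the cube and counting of polynomials\<close>

lemma f2_interpolation_family:
  assumes "finite \<A>" "finite U" "\<And>T. T \<in> \<A> \<Longrightarrow> T \<subseteq> U \<and> card T \<le> d"
  shows "\<exists>h. f2_degree_le U d h \<and> (\<forall>T\<in>\<A>. h T = f T)"
  using assms(1,3)
proof (induction \<A> rule: finite_ranking_induct[where f = card])
  case empty
  then show ?case using f2_zero by blast
next
  case (insert T \<A>)
  then obtain h where h: "f2_degree_le U d h" "\<forall>S\<in>\<A>. h S = f S" by auto
  show ?case
  proof (cases "T \<in> \<A> \<or> h T = f T")
    case True
    then show ?thesis using h by auto
  next
    case False
    have T: "T \<subseteq> U" "card T \<le> d" using insert.prems by auto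
    \<comment> \<open>Points are added in order of nondecreasing size, so no earlier point contains
      the new \<open>T\<close>. Its monomial therefore corrects the value at \<open>T\<close> and
      leaves all earlier values alone.\<close>
    have nsub: "\<not> T \<subseteq> S" if "S \<in> \<A>" for S
    proof
      assume "T \<subseteq> S"
      moreover have "finite S" "card S \<le> card T"
        using insert that finite_subset[OF _ assms(2)] by auto
      ultimately have "T = S" by (simp add: card_seteq)
      then show False using that False by simp
    qed
    have "\<forall>S\<in>insert T \<A>. ((T \<subseteq> S) \<noteq> h S) = f S" using nsub h(2) False by auto
    then show ?thesis using f2_add_monom[OF T h(1)] by blast
  qed
qed

lemma f2_interpolation_low:
  assumes "finite U"
  shows "\<exists>h. f2_degree_le U d h \<and> (\<forall>T\<subseteq>U. card T \<le> d \<longrightarrow> h T = f T)"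
proof -
  have "finite {T. T \<subseteq> U \<and> card T \<le> d}" using assms by simp
  from f2_interpolation_family[OF this assms, of d f] show ?thesis by auto
qed

text \<open>Complementation exchanges upper and lower layers and preserves the degree bound, which
  reduces the claim to the lower layers.\<close>

lemma f2_interpolation_high:
  assumes "finite U"
  shows "\<exists>h. f2_degree_le U d h \<and> (\<forall>T\<subseteq>U. card U \<le> card T + d \<longrightarrow> h T = f T)"
proof -
  obtain h where h: "f2_degree_le U d h"
      "\<forall>T\<subseteq>U. card T \<le> d \<longrightarrow> h T = f (U - T)"
    using f2_interpolation_low[OF assms, of d "\<lambda>T. f (U - T)"] by blast
  have "h (U - T) = f T" if "T \<subseteq> U" "card U \<le> card T + d" for T
  proof -
    have "card (U - T) \<le> d"
      using that assms by (simp add: card_Diff_subset finite_subset)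
    then have "h (U - T) = f (U - (U - T))" using h(2) by auto
    then show ?thesis using that(1) by (simp add: double_diff)
  qed
  then show ?thesis using f2_complement[OF assms h(1)] by blast
qed

text \<open>Every function of this kind is the sum \<open>ev\<close> of a set of monomials, and
  there are \<open>2 ^ card M\<close> such sets.\<close>

lemma card_f2_degree_le:
  assumes "finite U"
  shows "finite {f. f2_degree_le U d f}"
    and "card {f. f2_degree_le U d f} \<le> 2 ^ card {T. T \<subseteq> U \<and> card T \<le> d}"
proof -
  define M where "M = {T. T \<subseteq> U \<and> card T \<le> d}"
  define ev where "ev \<A> x = odd (card {T\<in>\<A>. T \<subseteq> x})" for \<A> :: "'a set set" and x
  have fin: "finite M" using assms by (simp add: M_def)
  have "f \<in> ev ` Pow M" if "f2_degree_le U d f" for f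
    using that
  proof (induction rule: f2_degree_le.induct)
    case f2_zero
    have "(\<lambda>_. False) = ev {}" by (simp add: ev_def fun_eq_iff)
    then show ?case by blast
  next
    case (f2_add_monom T f)
    then obtain \<A> where A: "\<A> \<subseteq> M" "f = ev \<A>" by auto
    have finA: "finite {S\<in>\<A>. S \<subseteq> x}" for x using finite_subset[OF A(1) fin] by simp
    have T: "T \<in> M" using f2_add_monom.hyps by (simp add: M_def)
    \<comment> \<open>Over two elements a repeated monomial cancels, so adding \<open>T\<close>
      toggles its membership in \<open>\<A>\<close>.\<close>
    show ?case
    proof (cases "T \<in> \<A>")
      case True
      have "((T \<subseteq> x) \<noteq> f x) = ev (\<A> - {T}) x" for x
      proof (cases "T \<subseteq> x")
        case s: True
        have "{S\<in>\<A>. S \<subseteq> x} = insert T {S\<in>\<A> - {T}. S \<subseteq> x}" using s True by auto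
        moreover have "finite {S\<in>\<A> - {T}. S \<subseteq> x}" using finA[of x] by (rule rev_finite_subset) auto
        ultimately show ?thesis using s by (simp add: A(2) ev_def)
      next
        case False
        then have "{S\<in>\<A>. S \<subseteq> x} = {S\<in>\<A> - {T}. S \<subseteq> x}" by auto
        then show ?thesis using False by (simp add: A(2) ev_def)
      qed
      then have "(\<lambda>x. (T \<subseteq> x) \<noteq> f x) = ev (\<A> - {T})" by (rule ext)
      moreover have "\<A> - {T} \<in> Pow M" using A(1) by auto
      ultimately show ?thesis by (rule image_eqI)
    next
      case False
      have "((T \<subseteq> x) \<noteq> f x) = ev (insert T \<A>) x" for x
      proof (cases "T \<subseteq> x")
        case s: True
        have "{S\<in>insert T \<A>. S \<subseteq> x} = insert T {S\<in>\<A>. S \<subseteq> x}" using s by auto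
        then show ?thesis using s finA[of x] False by (simp add: A(2) ev_def)
      next
        case s: False
        then have "{S\<in>insert T \<A>. S \<subseteq> x} = {S\<in>\<A>. S \<subseteq> x}" by auto
        then show ?thesis using s by (simp add: A(2) ev_def)
      qed
      then have "(\<lambda>x. (T \<subseteq> x) \<noteq> f x) = ev (insert T \<A>)" by (rule ext)
      moreover have "insert T \<A> \<in> Pow M" using A(1) T by auto
      ultimately show ?thesis by (rule image_eqI)
    qed
  qed
  then have sub: "{f. f2_degree_le U d f} \<subseteq> ev ` Pow M" by auto
  then show "finite {f. f2_degree_le U d f}" using fin by (meson finite_Pow_iff finite_imageI finite_subset)
  have "card {f. f2_degree_le U d f} \<le> card (ev ` Pow M)"
    using sub fin by (simp add: card_mono)
  also have "\<dots> \<le> card (Pow M)" using fin by (simp add: card_image_le)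
  finally show "card {f. f2_degree_le U d f} \<le> 2 ^ card {T. T \<subseteq> U \<and> card T \<le> d}"
    using fin by (simp add: card_Pow M_def)
qed

text \<open>If \<open>p\<close> is majority on \<open>Y\<close>, every function on \<open>Y\<close> has the form \<open>p h\<^sub>1 + (1 + p) h\<^sub>0\<close> with
  \<open>h\<^sub>0, h\<^sub>1\<close> of degree at most \<open>m\<close>, interpolating on the lower and on the upper half of the cube;
  then count polynomials.\<close>

lemma majority_agreement_le:
  assumes U: "finite U" "card U = 2 * m" and p: "f2_degree_le U D p"
    and Y: "Y \<subseteq> Pow U" "\<And>x. x \<in> Y \<Longrightarrow> p x = (card x > m)"
  shows "card Y \<le> card {T. T \<subseteq> U \<and> card T \<le> m + D}"
proof -
  have finY: "finite Y" using Y(1) U(1) finite_subset by auto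
  have "B \<in> (\<lambda>g. {x\<in>Y. g x}) ` {g. f2_degree_le U (m + D) g}" if B: "B \<subseteq> Y" for B
  proof -
    obtain h0 where h0: "f2_degree_le U m h0" "\<forall>T\<subseteq>U. card T \<le> m \<longrightarrow> h0 T = (T \<in> B)"
      using f2_interpolation_low[OF U(1), of m "\<lambda>T. T \<in> B"] by blast
    \<comment> \<open>As \<open>card U = 2 * m\<close>, the condition on \<open>T\<close> says
      \<open>m \<le> card T\<close>: \<open>h1\<close> covers the upper half, \<open>h0\<close> the
      lower one, and both cover the middle layer.\<close>
    obtain h1 where h1: "f2_degree_le U m h1"
        "\<forall>T\<subseteq>U. card U \<le> card T + m \<longrightarrow> h1 T = (T \<in> B)"
      using f2_interpolation_high[OF U(1), of m "\<lambda>T. T \<in> B"] by blast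
    define g where "g x = ((p x \<and> h1 x) \<noteq> (\<not> p x \<and> h0 x))" for x
    have "f2_degree_le U (D + m) g"
      unfolding g_def using p h0(1) h1(1) by (intro f2_add f2_mult f2_not)
    moreover have "B = {x\<in>Y. g x}"
    proof -
      have "g x = (x \<in> B)" if "x \<in> Y" for x
      proof -
        have "x \<subseteq> U" using that Y(1) by auto
        then show ?thesis
          using Y(2)[OF that] h0(2) h1(2) U(2) by (cases "card x > m") (auto simp: g_def)
      qed
      then show ?thesis using B by auto
    qed
    ultimately show ?thesis by (auto simp: add.commute)
  qed
  \<comment> \<open>Distinct subsets of \<open>Y\<close> are cut out by distinct polynomials of
    degree at most \<open>m + D\<close>, so the number of these polynomials bounds
    \<open>2 ^ card Y\<close>.\<close>
  then have "Pow Y \<subseteq> (\<lambda>g. {x\<in>Y. g x}) ` {g. f2_degree_le U (m + D) g}" by blast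
  then have "card (Pow Y) \<le> card ((\<lambda>g. {x\<in>Y. g x}) ` {g. f2_degree_le U (m + D) g})"
    using card_f2_degree_le(1)[OF U(1)] by (intro card_mono) auto
  also have "\<dots> \<le> card {g. f2_degree_le U (m + D) g}"
    using card_f2_degree_le(1)[OF U(1)] by (rule card_image_le)
  also have "\<dots> \<le> 2 ^ card {T. T \<subseteq> U \<and> card T \<le> m + D}"
    by (rule card_f2_degree_le(2)[OF U(1)])
  finally have "(2::nat) ^ card Y \<le> 2 ^ card {T. T \<subseteq> U \<and> card T \<le> m + D}"
    using finY by (simp add: card_Pow)
  then show ?thesis by simp
qed

section \<open>Approximation of circuits by polynomials\<close>

lemma card_even_inter_subsets_le:
  assumes "finite W" "w \<in> W" "w \<in> B"
  shows "2 * card {A. A \<subseteq> W \<and> even (card (A \<inter> B))} \<le> 2 ^ card W"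
proof -
  let ?E = "{A. A \<subseteq> W \<and> even (card (A \<inter> B))}" and ?O = "{A. A \<subseteq> W \<and> odd (card (A \<inter> B))}"
  \<comment> \<open>Toggling the fixed element \<open>w\<close> of \<open>B\<close> flips the parity
    of \<open>card (A \<inter> B)\<close>, so it injects the even subsets into the odd ones.\<close>
  define tog where "tog A = (if w \<in> A then A - {w} else insert w A)" for A
  have fin: "finite ?E" "finite ?O" using assms(1) by auto
  have "inj_on tog ?E"
    by (rule inj_on_inverseI[where g = tog]) (auto simp: tog_def)
  moreover have "tog ` ?E \<subseteq> ?O"
  proof
    fix C assume "C \<in> tog ` ?E"
    then obtain A where A: "A \<subseteq> W" "even (card (A \<inter> B))" "C = tog A" by auto
    have finA: "finite A" using A(1) assms(1) finite_subset by blast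
    show "C \<in> ?O"
    proof (cases "w \<in> A")
      case True
      have "A \<inter> B = insert w ((A - {w}) \<inter> B)" using True assms(3) by auto
      moreover have "card (insert w ((A - {w}) \<inter> B)) = Suc (card ((A - {w}) \<inter> B))"
        using finA by simp
      ultimately show ?thesis using A True by (auto simp: tog_def)
    next
      case False
      have "insert w A \<inter> B = insert w (A \<inter> B)" using assms(3) by auto
      then show ?thesis using A False finA assms(2) by (auto simp: tog_def)
    qed
  qed
  ultimately have "card ?E \<le> card ?O" using fin card_inj_on_le by blast
  moreover have "card ?E + card ?O = card (Pow W)"
  proof -
    have "Pow W = ?E \<union> ?O" "?E \<inter> ?O = {}" by auto
    then show ?thesis using fin card_Un_disjoint[of ?E ?O] by simp
  qed
  ultimately show ?thesis using assms(1) by (simp add: card_Pow)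
qed

text \<open>For each \<open>x\<close> some wire is true, so a uniformly random
  \<open>A \<subseteq> W\<close> contains an even number of true wires with probability at most 1/2.
  Double counting the pairs of \<open>A\<close> and \<open>x\<close> yields one \<open>A\<close>
  that fails on at most half of \<open>E\<close>.\<close>

lemma exists_parity_hitting_half:
  fixes P :: "'w \<Rightarrow> 'x \<Rightarrow> bool"
  assumes "finite W" "finite E" "\<And>x. x \<in> E \<Longrightarrow> \<exists>w\<in>W. P w x"
  shows "\<exists>A\<subseteq>W. 2 * card {x\<in>E. even (card {w\<in>A. P w x})} \<le> card E"
proof (rule ccontr)
  assume "\<not> ?thesis"
  then have big: "card E < 2 * card {x\<in>E. even (card {w\<in>A. P w x})}" if "A \<in> Pow W" for A
    using that by auto
  have "2 ^ card W * card E = (\<Sum>A\<in>Pow W. card E)" using assms(1) by (simp add: card_Pow)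
  also have "\<dots> < (\<Sum>A\<in>Pow W. 2 * card {x\<in>E. even (card {w\<in>A. P w x})})"
    using big assms(1) by (intro sum_strict_mono) auto
  also have "\<dots> = 2 * (\<Sum>A\<in>Pow W. \<Sum>x\<in>E. if even (card {w\<in>A. P w x}) then 1 else 0)"
    unfolding sum_distrib_left[symmetric] using assms(2) by (simp add: sum.If_cases Int_def)
  also have "\<dots> = 2 * (\<Sum>x\<in>E. \<Sum>A\<in>Pow W. if even (card {w\<in>A. P w x}) then 1 else 0)"
    by (subst sum.swap) simp
  also have "\<dots> = (\<Sum>x\<in>E. 2 * card {A. A \<subseteq> W \<and> even (card (A \<inter> {w. P w x}))})"
    unfolding sum_distrib_left[symmetric] using assms(1) by (simp add: sum.If_cases Int_def)
  also have "\<dots> \<le> (\<Sum>x\<in>E. 2 ^ card W)"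
  proof (rule sum_mono)
    fix x assume "x \<in> E"
    then obtain w where "w \<in> W" "P w x" using assms(3) by blast
    then show "2 * card {A. A \<subseteq> W \<and> even (card (A \<inter> {w. P w x}))} \<le> 2 ^ card W"
      using card_even_inter_subsets_le[OF assms(1), of w] by simp
  qed
  finally show False by simp
qed

lemma f2_parity_set:
  assumes "finite A" "\<And>w. w \<in> A \<Longrightarrow> f2_degree_le U d (P w)"
  shows "f2_degree_le U d (\<lambda>x. odd (card {w\<in>A. P w x}))"
proof -
  obtain ws where ws: "set ws = A" "distinct ws" using finite_distinct_list[OF assms(1)] by blast
  have "card {w\<in>A. P w x} = length (filter (\<lambda>w. P w x) ws)" for x
    using ws distinct_card[of "filter (\<lambda>w. P w x) ws"] by auto
  then show ?thesis using f2_parity_list[of ws U d P] assms(2) ws(1) by simp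
qed

text \<open>Razborov's approximation: \<open>p\<close> is a disjunction of \<open>l\<close>
  parities, each chosen to halve the set of remaining errors. The error stays one-sided, so at every
  error point some wire is true and a further parity can be chosen.\<close>

lemma f2_approx_or:
  assumes "finite \<Omega>" "finite W" "\<And>w. w \<in> W \<Longrightarrow> f2_degree_le U e (P w)"
  shows "\<exists>p. f2_degree_le U (l * e) p \<and> (\<forall>x. p x \<longrightarrow> (\<exists>w\<in>W. P w x)) \<and>
    2 ^ l * card {x\<in>\<Omega>. p x \<noteq> (\<exists>w\<in>W. P w x)} \<le> card \<Omega>"
proof (induction l)
  case 0
  have "card {x \<in> \<Omega>. False \<noteq> (\<exists>w\<in>W. P w x)} \<le> card \<Omega>"
    using assms(1) by (intro card_mono) auto
  then show ?case using f2_zero by (intro exI[of _ "\<lambda>_. False"]) auto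
next
  case (Suc l)
  then obtain p where p: "f2_degree_le U (l * e) p" "\<forall>x. p x \<longrightarrow> (\<exists>w\<in>W. P w x)"
      "2 ^ l * card {x\<in>\<Omega>. p x \<noteq> (\<exists>w\<in>W. P w x)} \<le> card \<Omega>" by blast
  define E where "E = {x\<in>\<Omega>. p x \<noteq> (\<exists>w\<in>W. P w x)}"
  have "\<exists>A\<subseteq>W. 2 * card {x\<in>E. even (card {w\<in>A. P w x})} \<le> card E"
    using assms(1,2) p(2) by (intro exists_parity_hitting_half) (auto simp: E_def)
  then obtain A where A: "A \<subseteq> W" "2 * card {x\<in>E. even (card {w\<in>A. P w x})} \<le> card E" by blast
  define g where "g x = odd (card {w\<in>A. P w x})" for x
  have g: "f2_degree_le U e g"
    unfolding g_def using A(1) assms finite_subset by (intro f2_parity_set) auto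
  have gor: "\<exists>w\<in>W. P w x" if "g x" for x
  proof -
    have "{w\<in>A. P w x} \<noteq> {}" using that unfolding g_def by (metis card.empty even_zero)
    then show ?thesis using A(1) by auto
  qed
  have "{x\<in>\<Omega>. (p x \<or> g x) \<noteq> (\<exists>w\<in>W. P w x)} = {x\<in>E. even (card {w\<in>A. P w x})}"
    using p(2) gor unfolding E_def g_def by auto
  then have "2 * card {x\<in>\<Omega>. (p x \<or> g x) \<noteq> (\<exists>w\<in>W. P w x)} \<le> card E" using A(2) by simp
  then have "2 ^ l * (2 * card {x\<in>\<Omega>. (p x \<or> g x) \<noteq> (\<exists>w\<in>W. P w x)}) \<le> 2 ^ l * card E"
    by simp
  also have "\<dots> \<le> card \<Omega>" using p(3) by (simp add: E_def)
  finally have "2 ^ Suc l * card {x\<in>\<Omega>. (p x \<or> g x) \<noteq> (\<exists>w\<in>W. P w x)} \<le> card \<Omega>"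
    by (simp add: algebra_simps)
  moreover have "f2_degree_le U (Suc l * e) (\<lambda>x. p x \<or> g x)"
    using f2_or[OF p(1) g] by (simp add: add.commute)
  moreover have "\<forall>x. p x \<or> g x \<longrightarrow> (\<exists>w\<in>W. P w x)" using p(2) gor by blast
  ultimately show ?case by (intro exI[of _ "\<lambda>x. p x \<or> g x"]) blast
qed

text \<open>Conjunctions are reduced to disjunctions by negation; parities and negations are exact,
  and \<open>0 < l\<close> gives \<open>e \<le> l * e\<close> for them. The error is relative to the
  supplied values \<open>vs x\<close>, which may themselves be approximations.\<close>

lemma f2_approx_gate:
  assumes "finite \<Omega>" "0 < l"
    and wires: "\<And>w. w \<in> gate_inputs g \<Longrightarrow> f2_degree_le U e (\<lambda>x. wire_val (\<phi> x) (vs x) w)"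
  shows "\<exists>p. f2_degree_le U (l * e) p \<and>
    2 ^ l * card {x\<in>\<Omega>. p x \<noteq> gate_val (\<phi> x) (vs x) g} \<le> card \<Omega>"
proof -
  let ?P = "\<lambda>w x. wire_val (\<phi> x) (vs x) w"
  have le: "e \<le> l * e" using assms(2) by simp
  show ?thesis
  proof (cases g)
    case (And ws)
    have "f2_degree_le U e (\<lambda>x. \<not> ?P w x)" if "w \<in> set ws" for w
      using wires that And by (intro f2_not) simp
    then obtain p where p: "f2_degree_le U (l * e) p"
      "2 ^ l * card {x\<in>\<Omega>. p x \<noteq> (\<exists>w\<in>set ws. \<not> ?P w x)} \<le> card \<Omega>"
      using f2_approx_or[OF assms(1), of "set ws" U e "\<lambda>w x. \<not> ?P w x" l] by auto
    have "{x\<in>\<Omega>. (\<not> p x) \<noteq> gate_val (\<phi> x) (vs x) g} = {x\<in>\<Omega>. p x \<noteq> (\<exists>w\<in>set ws. \<not> ?P w x)}"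
      using And by auto
    then show ?thesis using f2_not[OF p(1)] p(2) by (intro exI[of _ "\<lambda>x. \<not> p x"]) simp
  next
    case (Or ws)
    then show ?thesis
      using f2_approx_or[OF assms(1), of "set ws" U e ?P l] wires by auto
  next
    case (Xor ws)
    have "f2_degree_le U e (\<lambda>x. gate_val (\<phi> x) (vs x) g)"
      using f2_parity_list[of ws U e ?P] wires Xor by simp
    then show ?thesis using f2_mono[OF _ le] by (intro exI[of _ "\<lambda>x. gate_val (\<phi> x) (vs x) g"]) simp
  next
    case (Not w)
    have "f2_degree_le U e (\<lambda>x. gate_val (\<phi> x) (vs x) g)"
      using f2_not[of U e "?P w"] wires Not by simp
    then show ?thesis using f2_mono[OF _ le] by (intro exI[of _ "\<lambda>x. gate_val (\<phi> x) (vs x) g"]) simp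
  qed
qed

section \<open>Values and depths along a list of gates\<close>

definition gate_vals :: "('v \<Rightarrow> bool) \<Rightarrow> 'v gate list \<Rightarrow> bool list" where
  "gate_vals x gs = foldl (\<lambda>vs g. vs @ [gate_val x vs g]) [] gs"

definition gate_depths :: "'v gate list \<Rightarrow> nat list" where
  "gate_depths gs = foldl (\<lambda>ds g. ds @ [gate_depth ds g]) [] gs"

lemma gate_vals_simps [simp]:
  "gate_vals x [] = []"
  "gate_vals x (gs @ [g]) = gate_vals x gs @ [gate_val x (gate_vals x gs) g]"
  by (simp_all add: gate_vals_def)

lemma gate_depths_simps [simp]:
  "gate_depths [] = []"
  "gate_depths (gs @ [g]) = gate_depths gs @ [gate_depth (gate_depths gs) g]"
  by (simp_all add: gate_depths_def)

lemma length_gate_vals [simp]: "length (gate_vals x gs) = length gs"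
  by (induction gs rule: rev_induct) simp_all

lemma length_gate_depths [simp]: "length (gate_depths gs) = length gs"
  by (induction gs rule: rev_induct) simp_all

lemma wire_val_cong:
  assumes "w \<in> wires_available V n" "\<And>j. j < n \<Longrightarrow> vs ! j = vs' ! j"
  shows "wire_val x vs w = wire_val x vs' w"
  using assms by (cases w) (auto simp: wires_available_def)

lemma gate_val_cong:
  assumes "gate_inputs g \<subseteq> wires_available V n" "\<And>j. j < n \<Longrightarrow> vs ! j = vs' ! j"
  shows "gate_val x vs g = gate_val x vs' g"
proof -
  have "wire_val x vs w = wire_val x vs' w" if "w \<in> gate_inputs g" for w
    using that assms wire_val_cong by (metis subsetD)
  then show ?thesis by (cases g) (auto cong: filter_cong)
qed

lemma wire_depth_cong:
  assumes "w \<in> wires_available V n" "\<And>j. j < n \<Longrightarrow> ds ! j = ds' ! j"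
  shows "wire_depth ds w = wire_depth ds' w"
  using assms by (cases w) (auto simp: wires_available_def)

lemma gate_depth_cong:
  assumes "gate_inputs g \<subseteq> wires_available V n" "\<And>j. j < n \<Longrightarrow> ds ! j = ds' ! j"
  shows "gate_depth ds g = gate_depth ds' g"
proof -
  have "wire_depth ds ` gate_inputs g = wire_depth ds' ` gate_inputs g"
    using assms by (intro image_cong refl wire_depth_cong[of _ V n]) auto
  then show ?thesis by (simp add: gate_depth_def)
qed

text \<open>A gate reads only earlier entries and later gates never change these, so the complete
  list of values can replace the prefix from which the gate was evaluated.\<close>

lemma gate_vals_nth:
  assumes "\<And>i. i < length gs \<Longrightarrow> gate_inputs (gs ! i) \<subseteq> wires_available V i" "i < length gs"
  shows "gate_vals x gs ! i = gate_val x (gate_vals x gs) (gs ! i)"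
  using assms
proof (induction gs arbitrary: i rule: rev_induct)
  case (snoc g gs)
  have inp: "gate_inputs ((gs @ [g]) ! i) \<subseteq> wires_available V i" using snoc.prems by blast
  have pre: "(gate_vals x (gs @ [g])) ! j = gate_vals x gs ! j" if "j < length gs" for j
    using that by (simp add: nth_append)
  show ?case
  proof (cases "i < length gs")
    case True
    have "gate_vals x gs ! i = gate_val x (gate_vals x gs) (gs ! i)"
    proof (rule snoc.IH[OF _ True])
      fix j assume "j < length gs"
      then show "gate_inputs (gs ! j) \<subseteq> wires_available V j"
        using snoc.prems(1)[of j] by (simp add: nth_append)
    qed
    also have "\<dots> = gate_val x (gate_vals x (gs @ [g])) (gs ! i)"
      using inp True pre by (intro gate_val_cong[of _ V i]) (auto simp: nth_append)
    finally show ?thesis using True pre by (simp add: nth_append)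
  next
    case False
    then have i: "i = length gs" using snoc.prems by simp
    have "gate_val x (gate_vals x gs) g = gate_val x (gate_vals x (gs @ [g])) g"
      using inp i pre by (intro gate_val_cong[of _ V i]) auto
    then show ?thesis using i by (simp add: nth_append)
  qed
qed simp

lemma gate_depths_nth:
  assumes "\<And>i. i < length gs \<Longrightarrow> gate_inputs (gs ! i) \<subseteq> wires_available V i" "i < length gs"
  shows "gate_depths gs ! i = gate_depth (gate_depths gs) (gs ! i)"
  using assms
proof (induction gs arbitrary: i rule: rev_induct)
  case (snoc g gs)
  have inp: "gate_inputs ((gs @ [g]) ! i) \<subseteq> wires_available V i" using snoc.prems by blast
  have pre: "(gate_depths (gs @ [g])) ! j = gate_depths gs ! j" if "j < length gs" for j
    using that by (simp add: nth_append)
  show ?case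
  proof (cases "i < length gs")
    case True
    have "gate_depths gs ! i = gate_depth (gate_depths gs) (gs ! i)"
    proof (rule snoc.IH[OF _ True])
      fix j assume "j < length gs"
      then show "gate_inputs (gs ! j) \<subseteq> wires_available V j"
        using snoc.prems(1)[of j] by (simp add: nth_append)
    qed
    also have "\<dots> = gate_depth (gate_depths (gs @ [g])) (gs ! i)"
      using inp True pre by (intro gate_depth_cong[of _ V i]) (auto simp: nth_append)
    finally show ?thesis using True pre by (simp add: nth_append)
  next
    case False
    then have i: "i = length gs" using snoc.prems by simp
    have "gate_depth (gate_depths gs) g = gate_depth (gate_depths (gs @ [g])) g"
      using inp i pre by (intro gate_depth_cong[of _ V i]) auto
    then show ?thesis using i by (simp add: nth_append)
  qed
qed simp

lemma finite_gate_inputs: "finite (gate_inputs g)"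
  by (cases g) auto

lemma wire_depth_less_gate_depth:
  "w \<in> gate_inputs g \<Longrightarrow> wire_depth ds w < gate_depth ds g"
  unfolding gate_depth_def using finite_gate_inputs[of g] by (simp add: less_Suc_eq_le)

section \<open>Approximation along the gates\<close>

lemma f2_wire:
  assumes "w \<in> wires_available V (length ps)" "0 < l"
    and inputs: "\<And>v. v \<in> V \<Longrightarrow> f2_degree_le U 1 (\<lambda>x. \<phi> x v)"
    and ps: "\<And>j. j < length ps \<Longrightarrow> f2_degree_le U (l ^ (ds ! j)) (ps ! j)"
  shows "f2_degree_le U (l ^ wire_depth ds w) (\<lambda>x. wire_val (\<phi> x) (map (\<lambda>p. p x) ps) w)"
proof (cases w)
  case (Input v)
  then show ?thesis using assms(1) inputs by (auto simp: wires_available_def)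
next
  case (Gate j)
  then have "j < length ps" using assms(1) by (auto simp: wires_available_def)
  then show ?thesis using Gate ps[of j] by (simp add: eta_contract_eq)
qed

text \<open>Each gate is approximated from the polynomials of its inputs. This multiplies the degree
  by \<open>l\<close> per level and adds an error of at most a fraction 2^(-l) of
  \<open>\<Omega>\<close> per gate; outside the union of these errors all values are right.\<close>

lemma f2_approx_gates:
  assumes "finite \<Omega>" "0 < l"
    and inputs: "\<And>v. v \<in> V \<Longrightarrow> f2_degree_le U 1 (\<lambda>x. \<phi> x v)"
    and "\<And>i. i < length gs \<Longrightarrow> gate_inputs (gs ! i) \<subseteq> wires_available V i"
  shows "\<exists>ps. length ps = length gs \<and>
    (\<forall>i<length gs. f2_degree_le U (l ^ (gate_depths gs ! i)) (ps ! i)) \<and>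
    2 ^ l * card {x\<in>\<Omega>. map (\<lambda>p. p x) ps \<noteq> gate_vals (\<phi> x) gs} \<le> length gs * card \<Omega>"
  using assms(4)
proof (induction gs rule: rev_induct)
  case Nil
  then show ?case by simp
next
  case (snoc g gs)
  have "gate_inputs (gs ! i) \<subseteq> wires_available V i" if "i < length gs" for i
    using snoc.prems[of i] that by (simp add: nth_append)
  from snoc.IH[OF this] obtain ps where ps: "length ps = length gs"
      "\<And>i. i<length gs \<Longrightarrow> f2_degree_le U (l ^ (gate_depths gs ! i)) (ps ! i)"
      "2 ^ l * card {x\<in>\<Omega>. map (\<lambda>p. p x) ps \<noteq> gate_vals (\<phi> x) gs} \<le> length gs * card \<Omega>"
    by blast
  let ?vs = "\<lambda>x. map (\<lambda>p. p x) ps" and ?d = "gate_depth (gate_depths gs) g"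
  have "f2_degree_le U (l ^ (?d - 1)) (\<lambda>x. wire_val (\<phi> x) (?vs x) w)" if w: "w \<in> gate_inputs g" for w
  proof -
    have "w \<in> wires_available V (length ps)" using snoc.prems[of "length gs"] w ps(1) by auto
    then have "f2_degree_le U (l ^ wire_depth (gate_depths gs) w) (\<lambda>x. wire_val (\<phi> x) (?vs x) w)"
      using f2_wire[OF _ assms(2), of w V ps U \<phi>] inputs ps(1,2) by simp
    moreover have "l ^ wire_depth (gate_depths gs) w \<le> l ^ (?d - 1)"
      using wire_depth_less_gate_depth[OF w, of "gate_depths gs"] assms(2)
      by (intro power_increasing) auto
    ultimately show ?thesis by (rule f2_mono)
  qed
  from f2_approx_gate[OF assms(1,2) this] obtain p where p: "f2_degree_le U (l * l ^ (?d - 1)) p"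
      "2 ^ l * card {x\<in>\<Omega>. p x \<noteq> gate_val (\<phi> x) (?vs x) g} \<le> card \<Omega>" by blast
  \<comment> \<open>\<open>gate_depth\<close> is always a successor, so the truncated subtraction is
    exact.\<close>
  have "l * l ^ (?d - 1) = l ^ ?d"
    by (simp add: gate_depth_def)
  then have deg: "\<forall>i<length (gs @ [g]). f2_degree_le U (l ^ (gate_depths (gs @ [g]) ! i)) ((ps @ [p]) ! i)"
    using ps(1,2) p(1) by (auto simp: nth_append less_Suc_eq)
  have "{x\<in>\<Omega>. map (\<lambda>p. p x) (ps @ [p]) \<noteq> gate_vals (\<phi> x) (gs @ [g])} \<subseteq>
      {x\<in>\<Omega>. ?vs x \<noteq> gate_vals (\<phi> x) gs} \<union> {x\<in>\<Omega>. p x \<noteq> gate_val (\<phi> x) (?vs x) g}" by auto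
  from order_trans[OF card_mono[OF _ this] card_Un_le]
  have "card {x\<in>\<Omega>. map (\<lambda>p. p x) (ps @ [p]) \<noteq> gate_vals (\<phi> x) (gs @ [g])} \<le>
      card {x\<in>\<Omega>. ?vs x \<noteq> gate_vals (\<phi> x) gs} + card {x\<in>\<Omega>. p x \<noteq> gate_val (\<phi> x) (?vs x) g}"
    using assms(1) by simp
  then have "2 ^ l * card {x\<in>\<Omega>. map (\<lambda>p. p x) (ps @ [p]) \<noteq> gate_vals (\<phi> x) (gs @ [g])} \<le>
      2 ^ l * (card {x\<in>\<Omega>. ?vs x \<noteq> gate_vals (\<phi> x) gs} + card {x\<in>\<Omega>. p x \<noteq> gate_val (\<phi> x) (?vs x) g})"
    by simp
  also have "\<dots> \<le> length gs * card \<Omega> + card \<Omega>"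
    unfolding distrib_left using ps(3) p(2) by (rule add_mono)
  finally have "2 ^ l * card {x\<in>\<Omega>. map (\<lambda>p. p x) (ps @ [p]) \<noteq> gate_vals (\<phi> x) (gs @ [g])} \<le>
      length (gs @ [g]) * card \<Omega>" by simp
  then show ?case using deg ps(1) by (intro exI[of _ "ps @ [p]"]) simp
qed

text \<open>The output gate is approximated with a smaller parameter \<open>k\<close>: it contributes an error of only
  \<open>2\<^sup>-\<^sup>k\<close> once, and this is what makes the exponent \<open>h - 1\<close> instead of \<open>h\<close>.\<close>

lemma f2_approx_circuit:
  assumes "finite \<Omega>" "0 < l" "0 < k" "0 < h"
    and inputs: "\<And>v. v \<in> V \<Longrightarrow> f2_degree_le U 1 (\<lambda>x. \<phi> x v)"
    and C: "circuit_over V C" "circuit_depth C \<le> h"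
  shows "\<exists>p. f2_degree_le U (k * l ^ (h - 1)) p \<and>
    real (card {x\<in>\<Omega>. p x \<noteq> circuit_val C (\<phi> x)}) \<le> (circuit_size C / 2 ^ l + 1 / 2 ^ k) * card \<Omega>"
proof (cases "output_wire C")
  case (Input v)
  then have "v \<in> V" using C(1) by (auto simp: circuit_over_def wires_available_def)
  then have "f2_degree_le U 1 (\<lambda>x. circuit_val C (\<phi> x))" 
    using inputs Input by (simp add: circuit_val_def)
  then have "f2_degree_le U (k * l ^ (h - 1)) (\<lambda>x. circuit_val C (\<phi> x))"
    by (rule f2_mono) (use assms in simp)
  then show ?thesis by (intro exI[of _ "\<lambda>x. circuit_val C (\<phi> x)"]) simp
next
  case (Gate i)
  define gs where "gs = gates C"
  have i: "i < length gs" using C(1) Gate by (auto simp: circuit_over_def wires_available_def gs_def)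
  have avail: "\<And>i. i < length gs \<Longrightarrow> gate_inputs (gs ! i) \<subseteq> wires_available V i"
    using C(1) by (simp add: circuit_over_def gs_def)
  obtain ps where ps: "length ps = length gs"
      "\<And>i. i<length gs \<Longrightarrow> f2_degree_le U (l ^ (gate_depths gs ! i)) (ps ! i)"
      "2 ^ l * card {x\<in>\<Omega>. map (\<lambda>p. p x) ps \<noteq> gate_vals (\<phi> x) gs} \<le> length gs * card \<Omega>"
    using f2_approx_gates[OF assms(1,2), of V U \<phi> gs] inputs avail by blast
  have val: "circuit_val C (\<phi> x) = gate_val (\<phi> x) (gate_vals (\<phi> x) gs) (gs ! i)" for x
    using Gate gate_vals_nth[OF avail i] by (simp add: circuit_val_def gate_vals_def gs_def)
  have dep: "gate_depth (gate_depths gs) (gs ! i) \<le> h"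
    using C(2) Gate gate_depths_nth[OF avail i] by (simp add: circuit_depth_def gate_depths_def gs_def)
  let ?vs = "\<lambda>x. map (\<lambda>p. p x) ps"
  have "f2_degree_le U (l ^ (h - 1)) (\<lambda>x. wire_val (\<phi> x) (?vs x) w)" if w: "w \<in> gate_inputs (gs ! i)" for w
  proof -
    have "w \<in> wires_available V (length ps)" using avail[OF i] w i ps(1) by (auto simp: wires_available_def)
    then have "f2_degree_le U (l ^ wire_depth (gate_depths gs) w) (\<lambda>x. wire_val (\<phi> x) (?vs x) w)"
      using f2_wire[OF _ assms(2), of w V ps U \<phi>] inputs ps(1,2) by simp
    moreover have "l ^ wire_depth (gate_depths gs) w \<le> l ^ (h - 1)"
      using wire_depth_less_gate_depth[OF w, of "gate_depths gs"] assms(2) dep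
      by (intro power_increasing) auto
    ultimately show ?thesis by (rule f2_mono)
  qed
  from f2_approx_gate[OF assms(1,3) this] obtain p where p: "f2_degree_le U (k * l ^ (h - 1)) p"
      "2 ^ k * card {x\<in>\<Omega>. p x \<noteq> gate_val (\<phi> x) (?vs x) (gs ! i)} \<le> card \<Omega>" by blast
  let ?E1 = "{x\<in>\<Omega>. ?vs x \<noteq> gate_vals (\<phi> x) gs}"
    and ?E2 = "{x\<in>\<Omega>. p x \<noteq> gate_val (\<phi> x) (?vs x) (gs ! i)}"
  \<comment> \<open>Where \<open>?vs x\<close> is correct, only the new approximation of the output
    gate can be wrong.\<close>
  have "{x\<in>\<Omega>. p x \<noteq> circuit_val C (\<phi> x)} \<subseteq> ?E1 \<union> ?E2" using val by auto
  from order_trans[OF card_mono[OF _ this] card_Un_le]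
  have "card {x\<in>\<Omega>. p x \<noteq> circuit_val C (\<phi> x)} \<le> card ?E1 + card ?E2"
    using assms(1) by simp
  then have "real (card {x\<in>\<Omega>. p x \<noteq> circuit_val C (\<phi> x)}) \<le> real (card ?E1) + real (card ?E2)"
    by linarith
  also have "real (card ?E1) \<le> circuit_size C / 2 ^ l * card \<Omega>"
  proof -
    have "real (2 ^ l * card ?E1) \<le> real (length gs * card \<Omega>)" using ps(3) of_nat_le_iff by blast
    then show ?thesis by (simp add: circuit_size_def gs_def field_simps)
  qed
  also have "real (card ?E2) \<le> 1 / 2 ^ k * card \<Omega>"
  proof -
    have "real (2 ^ k * card ?E2) \<le> real (card \<Omega>)" using p(2) of_nat_le_iff by blast
    then show ?thesis by (simp add: field_simps)
  qed
  finally show ?thesis using p(1) by (intro exI[of _ p]) (simp add: algebra_simps)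
qed

section \<open>Reed-Solomon codes\<close>

text \<open>Coefficient lists have length exactly \<open>D\<close> with leading zeros allowed, so the words are the
  polynomials of degree less than \<open>D\<close>.\<close>

definition rs_code :: "('a, 'b) ring_scheme \<Rightarrow> nat \<Rightarrow> ('a \<Rightarrow> 'a) set" where
  "rs_code F D = (\<lambda>p. restrict (ring.eval F p) (carrier F)) ` {p. set p \<subseteq> carrier F \<and> length p = D}"

context field
begin

lemma eval_map2_minus:
  assumes "set p \<subseteq> carrier R" "set q \<subseteq> carrier R" "length p = length q" "a \<in> carrier R"
  shows "eval (map2 (\<lambda>b c. b \<ominus> c) p q) a = eval p a \<ominus> eval q a"
  using assms(3,1,2)
proof (induction p q rule: list_induct2)
  case Nil
  then show ?case by (simp add: minus_eq)
next
  case (Cons b p c q)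
  have "eval p a \<in> carrier R" "eval q a \<in> carrier R" "b \<in> carrier R" "c \<in> carrier R"
      "a [^] length q \<in> carrier R"
    using Cons eval_in_carrier assms(4) by auto
  then show ?case using Cons by simp algebra
qed

text \<open>Otherwise the difference \<open>s\<close> normalizes to a nonzero polynomial of degree
  below \<open>D\<close> with at least \<open>D\<close> roots.\<close>

lemma coeffs_eq_if_eval_eq:
  assumes p: "set p \<subseteq> carrier R" "length p = D" and q: "set q \<subseteq> carrier R" "length q = D"
    and T: "T \<subseteq> carrier R" "finite T" "D \<le> card T" and eq: "\<And>a. a \<in> T \<Longrightarrow> eval p a = eval q a"
  shows "p = q"
proof (rule ccontr)
  assume neq: "p \<noteq> q"
  define s where "s = map2 (\<lambda>b c. b \<ominus> c) p q"
  have sc: "set s \<subseteq> carrier R" "length s = D"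
    using p q by (auto simp: s_def subset_iff dest: set_zip_leftD set_zip_rightD)
  have ev: "eval (normalize s) a = \<zero>" if "a \<in> T" for a
  proof -
    have a: "a \<in> carrier R" using that T by auto
    have "eval s a = eval p a \<ominus> eval q a"
      unfolding s_def using eval_map2_minus p q a by simp
    then show ?thesis
      using eq[OF that] eval_normalize[OF sc(1) a] eval_in_carrier[OF q(1) a] by (simp add: r_neg minus_eq)
  qed
  obtain i where i: "i < D" "p ! i \<noteq> q ! i" using neq p q nth_equalityI by metis
  have car: "p ! i \<in> carrier R" "q ! i \<in> carrier R" using i p q by (metis nth_mem subsetD)+
  have "s ! i = p ! i \<ominus> q ! i" using i p q by (simp add: s_def)
  then have "s ! i \<noteq> \<zero>" using car i(2) by simp
  then have "s \<noteq> replicate D \<zero>" using i(1) by auto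
  then have nz: "normalize s \<noteq> []"
    using normalize_def'[of s] sc(2) by (metis append_Nil2 diff_zero list.size(3))
  have poly: "normalize s \<in> carrier (poly_ring R)"
    using normalize_gives_polynomial[OF sc(1)] by (simp add: univ_poly_carrier)
  have "T \<subseteq> set_mset (roots (normalize s))"
    using ev T(1) nz roots_mem_iff_is_root[OF poly] by (auto simp: is_root_def)
  then have "card T \<le> card (set_mset (roots (normalize s)))" by (simp add: card_mono)
  also have "\<dots> \<le> size (roots (normalize s))" 
    by (metis card_eq_sum size_multiset_overloaded_eq sum_mono count_greater_eq_one_iff)
  also have "\<dots> \<le> length (normalize s) - 1" by (rule size_roots_le_degree[OF poly])
  finally show False
    using T(3) nz normalize_length_le[of s] sc(2) by (metis One_nat_def Suc_pred length_greater_0_conv not_less_eq_eq order_trans)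
qed

text \<open>Evaluation on \<open>D\<close> points is injective on coefficient lists, and both sides
  have \<open>card (carrier R) ^ D\<close> elements. So any \<open>D\<close> coordinates of a word
  are free and determine it.\<close>

lemma rs_code_bij:
  assumes fin: "finite (carrier R)" and T: "T \<subseteq> carrier R" "card T = D"
  shows "bij_betw (\<lambda>f. restrict f T) (rs_code R D) (T \<rightarrow>\<^sub>E carrier R)"
proof -
  define L where "L = {p. set p \<subseteq> carrier R \<and> length p = D}"
  have finT: "finite T" using finite_subset[OF T(1) fin] .
  have finL: "finite L" and cardL: "card L = card (carrier R) ^ D"
    using finite_lists_length_eq[OF fin] card_lists_length_eq[OF fin] by (simp_all add: L_def)
  have finE: "finite (T \<rightarrow>\<^sub>E carrier R)" using fin finT by (simp add: finite_PiE)
  have inj: "inj_on (\<lambda>p. restrict (eval p) T) L"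
  proof (rule inj_onI)
    fix p q assume pq: "p \<in> L" "q \<in> L" "restrict (eval p) T = restrict (eval q) T"
    have "eval p a = eval q a" if "a \<in> T" for a using pq(3) that by (metis restrict_apply')
    then show "p = q"
      using coeffs_eq_if_eval_eq[of p D q T] pq(1,2) T finT by (auto simp: L_def)
  qed
  have sub: "(\<lambda>p. restrict (eval p) T) ` L \<subseteq> T \<rightarrow>\<^sub>E carrier R"
    using eval_in_carrier T(1) by (auto simp: L_def)
  have "card ((\<lambda>p. restrict (eval p) T) ` L) = card (T \<rightarrow>\<^sub>E carrier R)"
    using card_image[OF inj] cardL finT T(2) by (simp add: card_PiE)
  then have surj: "(\<lambda>p. restrict (eval p) T) ` L = T \<rightarrow>\<^sub>E carrier R"
    using card_subset_eq[OF finE sub] by simp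
  have rr: "restrict (restrict (eval p) (carrier R)) T = restrict (eval p) T" for p
    using T(1) by (simp add: Int_absorb1)
  show ?thesis
    unfolding bij_betw_def
  proof
    show "inj_on (\<lambda>f. restrict f T) (rs_code R D)"
      unfolding rs_code_def L_def[symmetric]
      by (rule inj_on_imageI) (use inj rr in \<open>simp add: comp_def\<close>)
    show "(\<lambda>f. restrict f T) ` rs_code R D = T \<rightarrow>\<^sub>E carrier R"
      unfolding rs_code_def L_def[symmetric] using surj rr by (simp add: image_image)
  qed
qed

lemma rs_code_subset: "rs_code R D \<subseteq> carrier R \<rightarrow>\<^sub>E carrier R"
  using eval_in_carrier by (auto simp: rs_code_def)

end

section \<open>Counting words with prescribed coordinates\<close>

lemma card_code_prescribed:
  assumes fin: "finite A" "finite B" and K: "K \<subseteq> A \<rightarrow>\<^sub>E B"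
    and bij: "\<And>T. T \<subseteq> A \<Longrightarrow> card T = D \<Longrightarrow> bij_betw (\<lambda>f. restrict f T) K (T \<rightarrow>\<^sub>E B)"
    and D: "D \<le> card A" and U: "U \<subseteq> A" "card U \<le> D" and v: "v \<in> U \<rightarrow> B"
  shows "card {f\<in>K. \<forall>a\<in>U. f a = v a} = card B ^ (D - card U)"
proof -
  have finU: "finite U" using finite_subset[OF U(1) fin(1)] .
  \<comment> \<open>\<open>U\<close> is enlarged to a set \<open>T\<close> of exactly
    \<open>D\<close> coordinates; words with the prescribed values on \<open>U\<close> then
    correspond to arbitrary values on \<open>W\<close>.\<close>
  obtain W where W: "W \<subseteq> A - U" "card W = D - card U"
    using obtain_subset_with_card_n[of "D - card U" "A - U"] D U card_Diff_subset[OF finU U(1)] 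
    by (metis diff_le_mono)
  have finW: "finite W" using W(1) fin(1) finite_subset by blast
  define T where "T = U \<union> W"
  have T: "T \<subseteq> A" "card T = D"
  proof -
    show "T \<subseteq> A" using U W by (auto simp: T_def)
    have "card T = card U + card W"
      unfolding T_def using finU finW W(1) by (intro card_Un_disjoint) auto
    then show "card T = D" using W(2) U(2) by simp
  qed
  define S where "S = {g \<in> T \<rightarrow>\<^sub>E B. \<forall>a\<in>U. g a = v a}"
  have S: "S = PiE T (\<lambda>a. if a \<in> U then {v a} else B)"
  proof (intro equalityI subsetI)
    fix g assume "g \<in> S"
    then show "g \<in> PiE T (\<lambda>a. if a \<in> U then {v a} else B)" by (auto simp: S_def PiE_iff)
  next
    fix g assume g: "g \<in> PiE T (\<lambda>a. if a \<in> U then {v a} else B)"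
    have "g a = v a" if "a \<in> U" for a using PiE_mem[OF g, of a] that by (simp add: T_def)
    moreover have "g a \<in> B" if "a \<in> T" for a
      using PiE_mem[OF g that] v by (auto split: if_splits)
    ultimately show "g \<in> S" using g by (simp add: S_def PiE_iff)
  qed
  have "bij_betw (\<lambda>f. restrict f T) {f\<in>K. \<forall>a\<in>U. f a = v a} S"
    unfolding bij_betw_def
  proof
    show "inj_on (\<lambda>f. restrict f T) {f\<in>K. \<forall>a\<in>U. f a = v a}"
      using bij[OF T] by (auto simp: bij_betw_def intro: inj_on_subset)
    have im: "(\<lambda>f. restrict f T) ` K = T \<rightarrow>\<^sub>E B" using bij[OF T] by (auto simp: bij_betw_def)
    show "(\<lambda>f. restrict f T) ` {f\<in>K. \<forall>a\<in>U. f a = v a} = S"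
    proof (intro equalityI subsetI)
      fix g assume "g \<in> (\<lambda>f. restrict f T) ` {f\<in>K. \<forall>a\<in>U. f a = v a}"
      then show "g \<in> S" using im by (auto simp: S_def T_def)
    next
      fix g assume g: "g \<in> S"
      then obtain f where f: "f \<in> K" "g = restrict f T"
        using im unfolding S_def by blast
      then have "\<forall>a\<in>U. f a = v a" using g by (auto simp: S_def T_def)
      then show "g \<in> (\<lambda>f. restrict f T) ` {f\<in>K. \<forall>a\<in>U. f a = v a}" using f by auto
    qed
  qed
  then have "card {f\<in>K. \<forall>a\<in>U. f a = v a} = card S" by (rule bij_betw_same_card)
  also have "\<dots> = (\<Prod>a\<in>T. card (if a \<in> U then {v a} else B))"
    unfolding S using finU finW by (simp add: card_PiE T_def)
  also have "\<dots> = (\<Prod>a\<in>U. card (if a \<in> U then {v a} else B)) * (\<Prod>a\<in>W. card (if a \<in> U then {v a} else B))"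
    unfolding T_def using finU finW W(1) by (intro prod.union_disjoint) auto
  also have "(\<Prod>a\<in>W. card (if a \<in> U then {v a} else B)) = (\<Prod>a\<in>W. card B)"
    using W(1) by (intro prod.cong) auto
  finally show ?thesis using W(2) by simp
qed

text \<open>\<open>D\<close> coordinates inside \<open>U\<close> already determine the word.\<close>

lemma card_code_agreeing:
  assumes fin: "finite A" "finite B" and K: "K \<subseteq> A \<rightarrow>\<^sub>E B"
    and bij: "\<And>T. T \<subseteq> A \<Longrightarrow> card T = D \<Longrightarrow> bij_betw (\<lambda>f. restrict f T) K (T \<rightarrow>\<^sub>E B)"
    and U: "U \<subseteq> A" "D \<le> card U"
  shows "card {g\<in>K. \<forall>a\<in>U. g a = f a} \<le> 1"
proof -
  obtain T where T: "T \<subseteq> U" "card T = D" using obtain_subset_with_card_n[OF U(2)] by metis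
  have inj: "inj_on (\<lambda>f. restrict f T) K" using bij[of T] T U by (auto simp: bij_betw_def)
  have "g = g'" if "g \<in> {g\<in>K. \<forall>a\<in>U. g a = f a}" "g' \<in> {g\<in>K. \<forall>a\<in>U. g a = f a}" for g g'
  proof -
    have "restrict g T = restrict g' T" using that T by (intro restrict_ext) auto
    then show ?thesis using that inj by (auto dest: inj_onD)
  qed
  moreover have "finite {g\<in>K. \<forall>a\<in>U. g a = f a}"
    using finite_subset[OF K] fin by (simp add: finite_PiE)
  ultimately show ?thesis using card_le_Suc0_iff_eq by (metis (no_types, lifting) One_nat_def)
qed

section \<open>Surviving words in a random set\<close>

text \<open>Chebyshev's argument: each zero of \<open>Z\<close> contributes
  \<open>\<mu>\<^sup>2\<close> to the sum of squared deviations from the mean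
  \<open>\<mu>\<close>.\<close>

lemma second_moment_zero:
  fixes Z :: "'s \<Rightarrow> real"
  assumes "finite \<Omega>" "0 < (\<Sum>s\<in>\<Omega>. Z s)"
  shows "real (card {s\<in>\<Omega>. Z s = 0}) \<le>
    (card \<Omega> * (\<Sum>s\<in>\<Omega>. (Z s)\<^sup>2) / (\<Sum>s\<in>\<Omega>. Z s)\<^sup>2 - 1) * card \<Omega>"
proof -
  define c where "c = real (card \<Omega>)"
  define s1 where "s1 = (\<Sum>s\<in>\<Omega>. Z s)"
  define s2 where "s2 = (\<Sum>s\<in>\<Omega>. (Z s)\<^sup>2)"
  have s1: "s1 > 0" using assms(2) by (simp add: s1_def)
  then have "\<Omega> \<noteq> {}" by (auto simp: s1_def)
  then have c: "c > 0" using assms(1) by (simp add: c_def card_gt_0_iff)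
  define \<mu> where "\<mu> = s1 / c"
  have "real (card {s\<in>\<Omega>. Z s = 0}) * \<mu>\<^sup>2 = (\<Sum>s\<in>{s\<in>\<Omega>. Z s = 0}. (Z s - \<mu>)\<^sup>2)" by simp
  also have "\<dots> \<le> (\<Sum>s\<in>\<Omega>. (Z s - \<mu>)\<^sup>2)"
    using assms(1) by (intro sum_mono2) auto
  also have "\<dots> = (\<Sum>s\<in>\<Omega>. (Z s)\<^sup>2 - 2 * \<mu> * Z s + \<mu>\<^sup>2)"
    by (simp add: power2_diff algebra_simps)
  also have "\<dots> = s2 - 2 * \<mu> * s1 + c * \<mu>\<^sup>2"
    by (simp add: sum.distrib sum_subtractf sum_distrib_left s1_def s2_def c_def)
  also have "\<dots> = s2 - s1\<^sup>2 / c"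
    using c by (simp add: \<mu>_def field_simps power2_eq_square)
  finally have "real (card {s\<in>\<Omega>. Z s = 0}) * (s1\<^sup>2 / c\<^sup>2) \<le> s2 - s1\<^sup>2 / c"
    by (simp add: \<mu>_def power_divide)
  then have "real (card {s\<in>\<Omega>. Z s = 0}) \<le> (s2 - s1\<^sup>2 / c) * (c\<^sup>2 / s1\<^sup>2)"
    using c s1 by (simp add: field_simps)
  also have "\<dots> = (c * s2 / s1\<^sup>2 - 1) * c"
    using c s1 by (simp add: field_simps power2_eq_square)
  finally show ?thesis by (simp add: c_def s1_def s2_def)
qed

lemma sum_Pow_power:
  fixes u :: real
  assumes "finite S"
  shows "(\<Sum>T\<in>Pow S. u ^ card T) = (1 + u) ^ card S"
  using prod_add[OF assms, of "\<lambda>_. u" "\<lambda>_. 1"] by (simp add: add.commute)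

section \<open>Random maps and the words that survive them\<close>

lemma card_maps_into:
  fixes N :: nat
  assumes "finite W" "G \<subseteq> W" "x \<subseteq> {..<N}" "0 < N"
  shows "real (card {\<sigma>\<in>W \<rightarrow>\<^sub>E {..<N}. \<forall>v\<in>G. \<sigma> v \<in> x}) =
    (real (card x) / N) ^ card G * real (card (W \<rightarrow>\<^sub>E {..<N}))"
proof -
  have finG: "finite G" using finite_subset[OF assms(2,1)] .
  \<comment> \<open>The condition defines a product set: values at different points are independent,
    and each point of \<open>G\<close> is sent into \<open>x\<close> with probability
    \<open>card x / N\<close>.\<close>
  have "{\<sigma>\<in>W \<rightarrow>\<^sub>E {..<N}. \<forall>v\<in>G. \<sigma> v \<in> x} = PiE W (\<lambda>v. if v \<in> G then x else {..<N})"
  proof (intro equalityI subsetI)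
    fix g assume "g \<in> {\<sigma>\<in>W \<rightarrow>\<^sub>E {..<N}. \<forall>v\<in>G. \<sigma> v \<in> x}"
    then show "g \<in> PiE W (\<lambda>v. if v \<in> G then x else {..<N})" by (auto simp: PiE_iff)
  next
    fix g assume g: "g \<in> PiE W (\<lambda>v. if v \<in> G then x else {..<N})"
    have "g v \<in> x" if "v \<in> G" for v using PiE_mem[OF g, of v] that assms(2) by auto
    moreover have "g v \<in> {..<N}" if "v \<in> W" for v
      using PiE_mem[OF g that] assms(3) by (auto split: if_splits)
    ultimately show "g \<in> {\<sigma>\<in>W \<rightarrow>\<^sub>E {..<N}. \<forall>v\<in>G. \<sigma> v \<in> x}" using g by (simp add: PiE_iff)
  qed
  then have "real (card {\<sigma>\<in>W \<rightarrow>\<^sub>E {..<N}. \<forall>v\<in>G. \<sigma> v \<in> x}) =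
      (\<Prod>v\<in>W. real (card (if v \<in> G then x else {..<N})))"
    using assms(1) by (simp add: card_PiE)
  also have "\<dots> = (\<Prod>v\<in>W. (if v \<in> G then real (card x) / N else 1) * N)"
    using assms(4) by (intro prod.cong) auto
  also have "\<dots> = (\<Prod>v\<in>W. if v \<in> G then real (card x) / N else 1) * (\<Prod>v\<in>W. real N)"
    by (rule prod.distrib)
  also have "(\<Prod>v\<in>W. if v \<in> G then real (card x) / N else 1) = (\<Prod>v\<in>G. real (card x) / N)"
    using assms(1,2) by (simp add: prod.If_cases Int_absorb1)
  finally show ?thesis using assms(1) by (simp add: card_PiE)
qed

text \<open>A union bound over \<open>K\<close>; the graph of each word has \<open>card I\<close>
  points.\<close>

lemma card_word_survives_le:
  fixes x :: "nat set" and K :: "('a \<Rightarrow> 'b) set"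
  assumes fin: "finite I" "finite B" "finite K" and K: "\<And>f a. f \<in> K \<Longrightarrow> a \<in> I \<Longrightarrow> f a \<in> B"
    and x: "x \<subseteq> {..<N}" "0 < N"
  shows "real (card {\<sigma>\<in>I \<times> B \<rightarrow>\<^sub>E {..<N}. \<exists>f\<in>K. \<forall>a\<in>I. \<sigma> (a, f a) \<in> x}) \<le>
    card K * (card x / N) ^ card I * card (I \<times> B \<rightarrow>\<^sub>E {..<N})"
proof -
  let ?\<Omega> = "I \<times> B \<rightarrow>\<^sub>E {..<N}"
  have "{\<sigma>\<in>?\<Omega>. \<exists>f\<in>K. \<forall>a\<in>I. \<sigma> (a, f a) \<in> x} = (\<Union>f\<in>K. {\<sigma>\<in>?\<Omega>. \<forall>a\<in>I. \<sigma> (a, f a) \<in> x})" by auto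
  then have "card {\<sigma>\<in>?\<Omega>. \<exists>f\<in>K. \<forall>a\<in>I. \<sigma> (a, f a) \<in> x} \<le>
      (\<Sum>f\<in>K. card {\<sigma>\<in>?\<Omega>. \<forall>a\<in>I. \<sigma> (a, f a) \<in> x})"
    using card_UN_le[OF fin(3)] by simp
  then have "real (card {\<sigma>\<in>?\<Omega>. \<exists>f\<in>K. \<forall>a\<in>I. \<sigma> (a, f a) \<in> x}) \<le>
      (\<Sum>f\<in>K. real (card {\<sigma>\<in>?\<Omega>. \<forall>a\<in>I. \<sigma> (a, f a) \<in> x}))"
    unfolding of_nat_sum[symmetric] by (rule of_nat_mono)
  also have "\<dots> = (\<Sum>f\<in>K. (card x / N) ^ card I * card ?\<Omega>)"
  proof (rule sum.cong)
    fix f assume f: "f \<in> K"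
    have "card ((\<lambda>a. (a, f a)) ` I) = card I" by (intro card_image inj_onI) simp
    then show "real (card {\<sigma>\<in>?\<Omega>. \<forall>a\<in>I. \<sigma> (a, f a) \<in> x}) = (card x / N) ^ card I * card ?\<Omega>"
      using card_maps_into[of "I \<times> B" "(\<lambda>a. (a, f a)) ` I" x N] fin K f x by auto
  qed simp
  finally show ?thesis by simp
qed

text \<open>The second moment method for the number \<open>Z\<close> of surviving words. With
  \<open>1 + u = 1 / p\<close>, two words that agree in j places survive together with probability
  \<open>p ^ (2 * n)\<close> times the j-th power of \<open>1 + u\<close>, and \<open>mds\<close>
  controls how often agreements occur.\<close>

lemma card_no_word_survives_le:
  fixes x :: "nat set" and K :: "('a \<Rightarrow> 'b) set" and q :: real
  assumes fin: "finite I" "finite B" "finite K" and K: "\<And>f a. f \<in> K \<Longrightarrow> a \<in> I \<Longrightarrow> f a \<in> B"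
    and x: "x \<subseteq> {..<N}" "0 < N" "x \<noteq> {}" and q: "0 < q" and ne: "K \<noteq> {}"
    and mds: "\<And>f T. f \<in> K \<Longrightarrow> T \<subseteq> I \<Longrightarrow>
      real (card {g\<in>K. \<forall>a\<in>T. g a = f a}) \<le> card K / q ^ card T + 1"
  shows "real (card {\<sigma>\<in>I \<times> B \<rightarrow>\<^sub>E {..<N}. \<not> (\<exists>f\<in>K. \<forall>a\<in>I. \<sigma> (a, f a) \<in> x)}) \<le>
    ((1 + (N / card x - 1) / q) ^ card I - 1 + 1 / (card K * (card x / N) ^ card I)) *
      card (I \<times> B \<rightarrow>\<^sub>E {..<N})"
proof -
  let ?\<Omega> = "I \<times> B \<rightarrow>\<^sub>E {..<N}"
  define n where "n = card I"
  define p where "p = real (card x) / N"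
  define u where "u = N / real (card x) - 1"
  define c where "c = real (card ?\<Omega>)"
  define Q where "Q = real (card K)"
  define hit where "hit f \<sigma> \<longleftrightarrow> (\<forall>a\<in>I. \<sigma> (a, f a) \<in> x)" for f and \<sigma> :: "'a \<times> 'b \<Rightarrow> nat"
  define Z where "Z \<sigma> = real (card {f\<in>K. hit f \<sigma>})" for \<sigma>
  have finx: "finite x" using x(1) finite_subset by blast
  have cx: "0 < card x" "card x \<le> N"
    using x finx card_mono[OF _ x(1)] by (auto simp: card_gt_0_iff)
  have p: "0 < p" using cx x(2) by (simp add: p_def)
  have u: "0 \<le> u" "1 + u = 1 / p" using cx by (auto simp: u_def p_def field_simps)
  have fin\<Omega>: "finite ?\<Omega>" using fin by (simp add: finite_PiE)
  have "?\<Omega> \<noteq> {}" using x(2) by (auto simp: PiE_eq_empty_iff)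
  then have c: "c > 0" using fin\<Omega> by (simp add: c_def card_gt_0_iff)
  have Q: "Q > 0" using fin(3) ne by (simp add: Q_def card_gt_0_iff)
  define gr where "gr f = (\<lambda>a. (a, f a)) ` I" for f :: "'a \<Rightarrow> 'b"
  have card_gr: "card (gr f) = n" for f
    unfolding gr_def n_def by (intro card_image inj_onI) simp
  have gr_sub: "gr f \<subseteq> I \<times> B" if "f \<in> K" for f using that K by (auto simp: gr_def)
  have Zsum: "Z \<sigma> = (\<Sum>f\<in>K. of_bool (hit f \<sigma>))" for \<sigma>
    using fin(3) by (simp add: Z_def of_bool_def sum.If_cases Int_def)
  have m1: "(\<Sum>\<sigma>\<in>?\<Omega>. of_bool (hit f \<sigma>)) = p ^ n * c" if f: "f \<in> K" for f
  proof -
    have "(\<Sum>\<sigma>\<in>?\<Omega>. of_bool (hit f \<sigma>)) = real (card {\<sigma>\<in>?\<Omega>. \<forall>v\<in>gr f. \<sigma> v \<in> x})"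
      using fin\<Omega> by (simp add: of_bool_def sum.If_cases Int_def hit_def gr_def)
    then show ?thesis
      using card_maps_into[of "I \<times> B" "gr f" x N] fin gr_sub[OF f] x card_gr by (simp add: p_def c_def)
  qed
  have s1: "(\<Sum>\<sigma>\<in>?\<Omega>. Z \<sigma>) = Q * p ^ n * c"
  proof -
    have "(\<Sum>\<sigma>\<in>?\<Omega>. Z \<sigma>) = (\<Sum>f\<in>K. \<Sum>\<sigma>\<in>?\<Omega>. of_bool (hit f \<sigma>))"
      unfolding Zsum by (rule sum.swap)
    then show ?thesis using m1 by (simp add: Q_def)
  qed
  have m2: "(\<Sum>\<sigma>\<in>?\<Omega>. of_bool (hit f \<sigma>) * of_bool (hit g \<sigma>)) =
      p ^ (2 * n) * c * (1 + u) ^ card {a\<in>I. g a = f a}" if fg: "f \<in> K" "g \<in> K" for f g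
  proof -
    have "(\<Sum>\<sigma>\<in>?\<Omega>. of_bool (hit f \<sigma>) * of_bool (hit g \<sigma>)) =
        real (card {\<sigma>\<in>?\<Omega>. \<forall>v\<in>gr f \<union> gr g. \<sigma> v \<in> x})"
    proof -
      have "hit f \<sigma> \<and> hit g \<sigma> \<longleftrightarrow> (\<forall>v\<in>gr f \<union> gr g. \<sigma> v \<in> x)" for \<sigma>
        by (auto simp: hit_def gr_def)
      then have "of_bool (hit f \<sigma>) * of_bool (hit g \<sigma>) =
          (if \<forall>v\<in>gr f \<union> gr g. \<sigma> v \<in> x then 1 else 0 :: real)" for \<sigma>
        by (metis of_bool_conj of_bool_def)
      then show ?thesis using fin\<Omega> by (simp add: sum.If_cases Int_def)
    qed
    also have "\<dots> = p ^ card (gr f \<union> gr g) * c"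
      using card_maps_into[of "I \<times> B" "gr f \<union> gr g" x N] fin gr_sub fg x by (simp add: p_def c_def)
    \<comment> \<open>The two graphs share one point per agreement, so their union falls short of
      \<open>2 * n\<close> points by the number of agreements; a factor \<open>1 + u = 1 / p\<close>
      makes up for each.\<close>
    also have "p ^ card (gr f \<union> gr g) = p ^ (2 * n) * (1 + u) ^ card {a\<in>I. g a = f a}"
    proof -
      have fing: "finite (gr f)" "finite (gr g)" using fin by (simp_all add: gr_def)
      have "gr f \<inter> gr g = (\<lambda>a. (a, f a)) ` {a\<in>I. g a = f a}" by (auto simp: gr_def)
      then have "card (gr f \<inter> gr g) = card {a\<in>I. g a = f a}"
        by (simp add: card_image inj_on_def)
      then have "card (gr f \<union> gr g) + card {a\<in>I. g a = f a} = 2 * n"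
        using card_Un_Int[OF fing] card_gr by simp
      then have "p ^ (2 * n) = p ^ card (gr f \<union> gr g) * p ^ card {a\<in>I. g a = f a}"
        by (metis power_add)
      then show ?thesis using p u(2) by (simp add: power_divide)
    qed
    finally show ?thesis by simp
  qed
  have inner: "(\<Sum>g\<in>K. (1 + u) ^ card {a\<in>I. g a = f a}) \<le> Q * (1 + u / q) ^ n + (1 + u) ^ n"
    if f: "f \<in> K" for f
  proof -
    \<comment> \<open>Expanding the power over the subsets \<open>T\<close> of the agreement set
      leads to counts of words that agree with \<open>f\<close> on \<open>T\<close>, to which
      \<open>mds\<close> applies.\<close>
    have "(\<Sum>g\<in>K. (1 + u) ^ card {a\<in>I. g a = f a}) =
        (\<Sum>g\<in>K. \<Sum>T\<in>Pow I. if \<forall>a\<in>T. g a = f a then u ^ card T else 0)"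
    proof (rule sum.cong)
      fix g
      have "(1 + u) ^ card {a\<in>I. g a = f a} = (\<Sum>T\<in>Pow {a\<in>I. g a = f a}. u ^ card T)"
        using fin(1) by (simp add: sum_Pow_power)
      also have "\<dots> = (\<Sum>T\<in>Pow I. if \<forall>a\<in>T. g a = f a then u ^ card T else 0)"
        using fin(1) by (intro sum.mono_neutral_cong_left) auto
      finally show "(1 + u) ^ card {a\<in>I. g a = f a} =
          (\<Sum>T\<in>Pow I. if \<forall>a\<in>T. g a = f a then u ^ card T else 0)" .
    qed simp
    also have "\<dots> = (\<Sum>T\<in>Pow I. \<Sum>g\<in>K. if \<forall>a\<in>T. g a = f a then u ^ card T else 0)"
      by (rule sum.swap)
    also have "\<dots> = (\<Sum>T\<in>Pow I. real (card {g\<in>K. \<forall>a\<in>T. g a = f a}) * u ^ card T)"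
      using fin(3) by (simp add: sum.If_cases Int_def)
    also have "\<dots> \<le> (\<Sum>T\<in>Pow I. (Q / q ^ card T + 1) * u ^ card T)"
      using mds[OF f] u(1) by (intro sum_mono mult_right_mono) (auto simp: Q_def)
    also have "\<dots> = (\<Sum>T\<in>Pow I. Q * (u / q) ^ card T + u ^ card T)"
      by (intro sum.cong) (simp_all add: algebra_simps power_divide)
    also have "\<dots> = Q * (\<Sum>T\<in>Pow I. (u / q) ^ card T) + (\<Sum>T\<in>Pow I. u ^ card T)"
      by (simp add: sum.distrib sum_distrib_left)
    also have "\<dots> = Q * (1 + u / q) ^ n + (1 + u) ^ n"
      using fin(1) by (simp only: sum_Pow_power n_def)
    finally show ?thesis .
  qed
  have s2: "(\<Sum>\<sigma>\<in>?\<Omega>. (Z \<sigma>)\<^sup>2) \<le> Q * (p ^ (2 * n) * c * (Q * (1 + u / q) ^ n + (1 + u) ^ n))"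
  proof -
    have "(\<Sum>\<sigma>\<in>?\<Omega>. (Z \<sigma>)\<^sup>2) = (\<Sum>\<sigma>\<in>?\<Omega>. \<Sum>f\<in>K. \<Sum>g\<in>K. of_bool (hit f \<sigma>) * of_bool (hit g \<sigma>))"
      unfolding Zsum power2_eq_square sum_product ..
    also have "\<dots> = (\<Sum>f\<in>K. \<Sum>\<sigma>\<in>?\<Omega>. \<Sum>g\<in>K. of_bool (hit f \<sigma>) * of_bool (hit g \<sigma>))"
      by (rule sum.swap)
    also have "\<dots> = (\<Sum>f\<in>K. \<Sum>g\<in>K. \<Sum>\<sigma>\<in>?\<Omega>. of_bool (hit f \<sigma>) * of_bool (hit g \<sigma>))"
      by (intro sum.cong refl sum.swap)
    also have "\<dots> = (\<Sum>f\<in>K. \<Sum>g\<in>K. p ^ (2 * n) * c * (1 + u) ^ card {a\<in>I. g a = f a})"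
      by (intro sum.cong refl m2)
    also have "\<dots> = (\<Sum>f\<in>K. p ^ (2 * n) * c * (\<Sum>g\<in>K. (1 + u) ^ card {a\<in>I. g a = f a}))"
      by (simp only: sum_distrib_left)
    also have "\<dots> \<le> (\<Sum>f\<in>K. p ^ (2 * n) * c * (Q * (1 + u / q) ^ n + (1 + u) ^ n))"
      using p c by (intro sum_mono mult_left_mono inner) auto
    finally show ?thesis by (simp add: Q_def)
  qed
  have "{\<sigma>\<in>?\<Omega>. \<not> (\<exists>f\<in>K. \<forall>a\<in>I. \<sigma> (a, f a) \<in> x)} = {\<sigma>\<in>?\<Omega>. Z \<sigma> = 0}"
    using fin(3) by (auto simp: Z_def hit_def)
  then have "real (card {\<sigma>\<in>?\<Omega>. \<not> (\<exists>f\<in>K. \<forall>a\<in>I. \<sigma> (a, f a) \<in> x)}) \<le>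
      (c * (\<Sum>\<sigma>\<in>?\<Omega>. (Z \<sigma>)\<^sup>2) / (\<Sum>\<sigma>\<in>?\<Omega>. Z \<sigma>)\<^sup>2 - 1) * c"
    using second_moment_zero[OF fin\<Omega>, of Z] s1 Q p c by (simp add: c_def)
  also have "\<dots> \<le> (c * (Q * (p ^ (2 * n) * c * (Q * (1 + u / q) ^ n + (1 + u) ^ n))) / (Q * p ^ n * c)\<^sup>2 - 1) * c"
    unfolding s1 using s2 c by (intro mult_right_mono diff_right_mono divide_right_mono mult_left_mono) auto
  \<comment> \<open>After division by the squared mean, the part \<open>Q / q ^ card T\<close> of
    \<open>mds\<close> leaves \<open>(1 + u / q) ^ n\<close>, and the part 1 leaves
    \<open>1 / (Q * p ^ n)\<close>, the reciprocal of the expected number of survivors.\<close>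
  also have "c * (Q * (p ^ (2 * n) * c * (Q * (1 + u / q) ^ n + (1 + u) ^ n))) / (Q * p ^ n * c)\<^sup>2 =
      (1 + u / q) ^ n + 1 / (Q * p ^ n)"
  proof -
    have "(1 + u) ^ n = 1 / p ^ n" using u(2) by (simp add: power_divide)
    moreover have "p ^ (2 * n) = (p ^ n)\<^sup>2" by (simp add: power_mult mult.commute)
    moreover have "p ^ n > 0" using p by simp
    ultimately show ?thesis using c Q p by (simp add: field_simps power2_eq_square)
  qed
  finally show ?thesis unfolding u_def p_def Q_def c_def n_def by (simp add: algebra_simps)
qed

section \<open>Reduction from majority\<close>

lemma central_binomial_sq_le: "((2 * m) choose m)\<^sup>2 * (2 * m + 1) \<le> 16 ^ m"
proof (induction m)
  case (Suc m)
  define b where "b = (2 * m) choose m"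
  define b' where "b' = (2 * Suc m) choose Suc m"
  have "Suc m * b' = 2 * Suc m * ((2 * m + 1) choose m)"
    using Suc_times_binomial_eq[of "2 * m + 1" m] by (simp add: b'_def mult.commute)
  then have e1: "b' = 2 * ((2 * m + 1) choose m)" by (metis mult.assoc mult.left_commute mult_left_cancel nat.distinct(1))
  have "(2 * m + 1) choose m = (2 * m + 1) choose Suc m"
    using binomial_symmetric[of m "2 * m + 1"] by simp
  then have "Suc m * ((2 * m + 1) choose m) = (2 * m + 1) * b"
    using Suc_times_binomial_eq[of "2 * m" m] by (simp add: b_def mult.commute)
  \<comment> \<open>The recurrence of the central binomial coefficients; the induction then rests on
    \<open>(2 * m + 1) * (2 * m + 3) \<le> 4 * (Suc m)\<^sup>2\<close>.\<close>
  then have e: "Suc m * b' = 2 * (2 * m + 1) * b" using e1 by (metis mult.assoc mult.left_commute)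
  have "(Suc m)\<^sup>2 * (b'\<^sup>2 * (2 * Suc m + 1)) = (Suc m * b')\<^sup>2 * (2 * Suc m + 1)"
    by (simp only: power_mult_distrib mult.assoc)
  also have "\<dots> = 4 * ((2 * m + 1) * (2 * m + 3)) * (b\<^sup>2 * (2 * m + 1))"
    unfolding e by (simp add: power_mult_distrib power2_eq_square algebra_simps)
  also have "\<dots> \<le> 4 * (4 * (Suc m)\<^sup>2) * 16 ^ m"
  proof (rule mult_le_mono)
    show "4 * ((2 * m + 1) * (2 * m + 3)) \<le> 4 * (4 * (Suc m)\<^sup>2)" by (simp add: power2_eq_square algebra_simps)
    show "b\<^sup>2 * (2 * m + 1) \<le> 16 ^ m" using Suc by (simp add: b_def)
  qed
  also have "\<dots> = (Suc m)\<^sup>2 * 16 ^ Suc m" by simp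
  finally show ?case unfolding b'_def using mult_le_cancel1[of "(Suc m)\<^sup>2"] by (metis zero_less_Suc zero_less_power)
qed simp

text \<open>Taking \<open>m\<close> to be a square makes its root the integer \<open>t\<close>: for
  \<open>0 < t\<close>, every layer of the cube of dimension \<open>2 * m\<close> has density at
  most \<open>1 / t\<close>.\<close>

lemma central_binomial_square_le:
  assumes "m = t\<^sup>2"
  shows "real t * real ((2 * m) choose m) \<le> 4 ^ m"
proof -
  have "(t * ((2 * m) choose m))\<^sup>2 \<le> ((2 * m) choose m)\<^sup>2 * (2 * m + 1)"
    using assms by (simp add: power_mult_distrib)
  also have "\<dots> \<le> (4 ^ m)\<^sup>2" using central_binomial_sq_le[of m] by (simp add: power2_eq_square flip: power_mult_distrib)
  finally have "t * ((2 * m) choose m) \<le> 4 ^ m" by (rule power2_le_imp_le) simp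
  then have "real (t * ((2 * m) choose m)) \<le> real (4 ^ m)" by (rule of_nat_mono)
  then show ?thesis by simp
qed

lemma card_subsets_with_sizes_le:
  assumes "finite U" "card U = 2 * m" "finite S"
  shows "card {x. x \<subseteq> U \<and> card x \<in> S} \<le> card S * ((2 * m) choose m)"
proof -
  have "{x. x \<subseteq> U \<and> card x \<in> S} = (\<Union>k\<in>S. {x. x \<subseteq> U \<and> card x = k})" by auto
  then have "card {x. x \<subseteq> U \<and> card x \<in> S} \<le> (\<Sum>k\<in>S. card {x. x \<subseteq> U \<and> card x = k})"
    using card_UN_le[OF assms(3)] by simp
  also have "\<dots> = (\<Sum>k\<in>S. (2 * m) choose k)" using n_subsets[OF assms(1)] assms(2) by simp
  also have "\<dots> \<le> (\<Sum>k\<in>S. (2 * m) choose m)" by (intro sum_mono binomial_maximum')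
  finally show ?thesis by simp
qed

text \<open>By complementation the layers below \<open>m\<close> fill at most half of the cube, and
  each of the remaining \<open>D + 1\<close> layers is at most as large as the central one.\<close>

lemma card_subsets_small_le:
  assumes "finite U" "card U = 2 * m"
  shows "real (card {T. T \<subseteq> U \<and> card T \<le> m + D}) \<le> 4 ^ m / 2 + (D + 1) * real ((2 * m) choose m)"
proof -
  let ?L = "{T. T \<subseteq> U \<and> card T < m}" and ?H = "{T. T \<subseteq> U \<and> m < card T}"
  have fin: "finite ?L" "finite ?H" using assms(1) by auto
  have "inj_on (\<lambda>T. U - T) ?L" by (rule inj_on_inverseI[where g = "\<lambda>T. U - T"]) auto
  moreover have "(\<lambda>T. U - T) ` ?L \<subseteq> ?H"
  proof
    fix S assume "S \<in> (\<lambda>T. U - T) ` ?L"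
    then obtain T where T: "T \<subseteq> U" "card T < m" "S = U - T" by auto
    then have "card S = 2 * m - card T"
      using assms by (simp add: card_Diff_subset finite_subset)
    then show "S \<in> ?H" using T by auto
  qed
  ultimately have "card ?L \<le> card ?H" using fin card_inj_on_le by blast
  moreover have "card ?L + card ?H \<le> card (Pow U)"
  proof -
    have "card ?L + card ?H = card (?L \<union> ?H)" using fin by (intro card_Un_disjoint[symmetric]) auto
    also have "\<dots> \<le> card (Pow U)" using assms(1) by (intro card_mono) auto
    finally show ?thesis .
  qed
  moreover have "card (Pow U) = 4 ^ m" using assms by (simp add: card_Pow power_mult)
  ultimately have L: "2 * card ?L \<le> 4 ^ m" by linarith
  then have "real (2 * card ?L) \<le> real (4 ^ m)" by (rule of_nat_mono)
  then have L: "real (card ?L) \<le> 4 ^ m / 2" by simp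
  have "{T. T \<subseteq> U \<and> card T \<le> m + D} \<subseteq> ?L \<union> {T. T \<subseteq> U \<and> card T \<in> {m..m+D}}" by auto
  then have "card {T. T \<subseteq> U \<and> card T \<le> m + D} \<le> card (?L \<union> {T. T \<subseteq> U \<and> card T \<in> {m..m+D}})"
    using assms(1) by (intro card_mono) auto
  also have "\<dots> \<le> card ?L + card {T. T \<subseteq> U \<and> card T \<in> {m..m+D}}" by (rule card_Un_le)
  also have "\<dots> \<le> card ?L + (D + 1) * ((2 * m) choose m)"
    using card_subsets_with_sizes_le[OF assms, of "{m..m+D}"] by simp
  finally have "real (card {T. T \<subseteq> U \<and> card T \<le> m + D}) \<le> real (card ?L + (D + 1) * ((2 * m) choose m))"
    by (rule of_nat_mono)
  also have "\<dots> = real (card ?L) + (real D + 1) * real ((2 * m) choose m)" by (simp add: algebra_simps)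
  finally show ?thesis using L by linarith
qed

section \<open>Circuits that nearly compute majority\<close>

lemma circuit_majority_bound:
  fixes \<phi> :: "nat set \<Rightarrow> 'v \<Rightarrow> bool" and m t :: nat
  assumes "0 < t" "m = t\<^sup>2" "2 \<le> h"
    and inputs: "\<And>v. v \<in> V \<Longrightarrow> f2_degree_le {..<2 * m} 1 (\<lambda>x. \<phi> x v)"
    and C: "circuit_over V C" "circuit_depth C \<le> h" "circuit_size C \<le> 2 ^ s"
    and err: "real (card {x\<in>Pow {..<2 * m}. circuit_val C (\<phi> x) \<noteq> (m < card x)}) \<le>
      (9 / 50 + 1 / t) * 4 ^ m"
  shows "t \<le> 28 * (s + 5) ^ (h - 1)"
proof -
  define U where "U = {..<2 * m}"
  define L where "L = (s + 5) ^ (h - 1)"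
  define D where "D = 5 * L"
  have U: "finite U" "card U = 2 * m" by (simp_all add: U_def)
  have cP: "real (card (Pow U)) = 4 ^ m" using U by (simp add: card_Pow power_mult)
  \<comment> \<open>The inner gates, with parameter \<open>s + 5\<close> and at most
    \<open>2 ^ s\<close> of them, and the output gate, with parameter 5, each contribute an error of
    at most 1/32.\<close>
  obtain p where p: "f2_degree_le U D p"
      "real (card {x\<in>Pow U. p x \<noteq> circuit_val C (\<phi> x)}) \<le>
        (circuit_size C / 2 ^ (s + 5) + 1 / 2 ^ 5) * card (Pow U)"
    using f2_approx_circuit[of "Pow U" "s + 5" 5 h V U \<phi> C] inputs C(1,2) assms(3) U(1)
    unfolding D_def L_def U_def by auto
  have "real (circuit_size C) \<le> 2 ^ s" using of_nat_mono[OF C(3), where 'a = real] by simp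
  then have "circuit_size C / 2 ^ (s + 5) \<le> (1 / 32 :: real)" by (simp add: power_add field_simps)
  then have "(circuit_size C / 2 ^ (s + 5) + 1 / 2 ^ 5) * card (Pow U) \<le> (1 / 32 + 1 / 32) * real (card (Pow U))"
    by (intro mult_right_mono add_mono) simp_all
  from order_trans[OF p(2) this]
  have e1: "real (card {x\<in>Pow U. p x \<noteq> circuit_val C (\<phi> x)}) \<le> 1 / 16 * 4 ^ m"
    unfolding cP by simp
  define Y where "Y = {x\<in>Pow U. p x = (m < card x)}"
  have "Pow U \<subseteq> Y \<union> ({x\<in>Pow U. p x \<noteq> circuit_val C (\<phi> x)} \<union>
      {x\<in>Pow U. circuit_val C (\<phi> x) \<noteq> (m < card x)})" by (auto simp: Y_def)
  then have "card (Pow U) \<le> card (Y \<union> ({x\<in>Pow U. p x \<noteq> circuit_val C (\<phi> x)} \<union>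
      {x\<in>Pow U. circuit_val C (\<phi> x) \<noteq> (m < card x)}))"
    using U(1) by (intro card_mono) (auto simp: Y_def)
  also have "\<dots> \<le> card Y + (card {x\<in>Pow U. p x \<noteq> circuit_val C (\<phi> x)} +
      card {x\<in>Pow U. circuit_val C (\<phi> x) \<noteq> (m < card x)})"
    by (rule order_trans[OF card_Un_le add_left_mono[OF card_Un_le]])
  finally have "real (card (Pow U)) \<le> real (card Y + (card {x\<in>Pow U. p x \<noteq> circuit_val C (\<phi> x)} +
      card {x\<in>Pow U. circuit_val C (\<phi> x) \<noteq> (m < card x)}))" by (rule of_nat_mono)
  then have lower: "4 ^ m \<le> real (card Y) + 1 / 16 * 4 ^ m + (9 / 50 + 1 / t) * 4 ^ m"
    using e1 err cP by (simp add: U_def)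
  have "card Y \<le> card {T. T \<subseteq> U \<and> card T \<le> m + D}"
    by (rule majority_agreement_le[OF U p(1)]) (auto simp: Y_def)
  then have "real (card Y) \<le> real (card {T. T \<subseteq> U \<and> card T \<le> m + D})" by (rule of_nat_mono)
  also have "\<dots> \<le> 4 ^ m / 2 + (real D + 1) * real ((2 * m) choose m)"
    by (rule card_subsets_small_le[OF U])
  also have "\<dots> \<le> 4 ^ m / 2 + (real D + 1) * (4 ^ m / t)"
  proof -
    have "real ((2 * m) choose m) \<le> 4 ^ m / t"
      using central_binomial_square_le[OF assms(2)] assms(1) by (simp add: field_simps)
    then show ?thesis by (intro add_left_mono mult_left_mono) auto
  qed
  finally have "4 ^ m \<le> 4 ^ m / 2 + (real D + 1) * (4 ^ m / t) + 1 / 16 * 4 ^ m + (9 / 50 + 1 / t) * 4 ^ m"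
    using lower by linarith
  also have "\<dots> = 4 ^ m * (1 / 2 + (real D + 1) / t + 1 / 16 + 9 / 50 + 1 / t)"
    by (simp add: algebra_simps)
  finally have "4 ^ m * 1 \<le> 4 ^ m * (1 / 2 + (real D + 1) / t + 1 / 16 + 9 / 50 + 1 / t)" by simp
  then have "1 \<le> 1 / 2 + (real D + 1) / t + 1 / 16 + 9 / 50 + 1 / t"
    by (subst (asm) mult_le_cancel_left_pos) simp_all
  \<comment> \<open>What remains is 1 - 1/2 - 1/16 - 9/50 = 0.2575, just above 1/4.\<close>
  then have "1 / 4 \<le> (real D + 2) / t" by (simp add: add_divide_distrib)
  then have "real t \<le> 4 * (real D + 2)" using assms(1) by (simp add: field_simps)
  then have "real t \<le> real (4 * (D + 2))" by simp
  then have "t \<le> 4 * (D + 2)" by (simp only: of_nat_le_iff)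
  \<comment> \<open>This absorbs the additive constant:
    \<open>4 * (5 * L + 2) \<le> 28 * L\<close>.\<close>
  moreover have "1 \<le> L" by (simp add: L_def)
  ultimately have "t \<le> 28 * L" by (simp add: D_def)
  then show ?thesis by (simp add: L_def)
qed

section \<open>Averaging over projections\<close>

lemma one_plus_inverse_power_le:
  fixes q :: real
  assumes "0 < q" "20 * real n \<le> q"
  shows "(1 + 1 / q) ^ n \<le> 20 / 19"
proof -
  show ?thesis
  proof (cases "n = 0")
    case False
    then have "1 \<le> real n" by simp
    then have q: "q \<ge> 20" using assms(2) by linarith
    have "1 - 1 / 20 \<le> 1 + real n * (- (1 / q))" using assms by (simp add: field_simps)
    also have "\<dots> \<le> (1 + (- (1 / q))) ^ n" by (rule Bernoulli_inequality) (use q in simp)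
    finally have a: "19 / 20 \<le> (1 - 1 / q) ^ n" by simp
    \<comment> \<open>Bernoulli's lower bound for \<open>(1 - 1 / q) ^ n\<close> becomes an upper
      bound for \<open>(1 + 1 / q) ^ n\<close>, since their product is at most 1.\<close>
    have "(1 - 1 / q) ^ n * (1 + 1 / q) ^ n = ((1 - 1 / q) * (1 + 1 / q)) ^ n" by (simp add: power_mult_distrib)
    also have "\<dots> \<le> 1"
    proof (rule power_le_one)
      show "0 \<le> (1 - 1 / q) * (1 + 1 / q)" using q by simp
      show "(1 - 1 / q) * (1 + 1 / q) \<le> 1" using q by (simp add: field_simps)
    qed
    finally have b: "(1 - 1 / q) ^ n * (1 + 1 / q) ^ n \<le> 1" .
    have "19 / 20 * (1 + 1 / q) ^ n \<le> (1 - 1 / q) ^ n * (1 + 1 / q) ^ n"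
      using a q by (intro mult_right_mono) auto
    then show ?thesis using b by simp
  qed simp
qed

text \<open>For a fixed \<open>x\<close> outside the window \<open>W\<close> of sizes near
  \<open>m\<close>, a random \<open>\<sigma>\<close> errs with probability at most 2/25; the window
  holds a fraction of at most \<open>1 / 10 + 1 / t\<close> of all \<open>x\<close>. Averaging
  yields one \<open>\<sigma>\<close> with error fraction at most
  \<open>9 / 50 + 1 / t\<close>.\<close>

lemma exists_projection_to_majority:
  fixes K :: "('a \<Rightarrow> 'b) set" and q :: real and m n t :: nat
  assumes fin: "finite I" "finite B" "finite K" and K: "\<And>f a. f \<in> K \<Longrightarrow> a \<in> I \<Longrightarrow> f a \<in> B"
    and q: "0 < q" "20 * real n \<le> q" and n: "card I = n" "800 * t \<le> n" and t: "0 < t" "m = t\<^sup>2"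
    and cK: "2 ^ n \<le> card K" "card K < 2 ^ (n + 1)"
    and mds: "\<And>f T. f \<in> K \<Longrightarrow> T \<subseteq> I \<Longrightarrow>
      real (card {g\<in>K. \<forall>a\<in>T. g a = f a}) \<le> card K / q ^ card T + 1"
  shows "\<exists>\<sigma>\<in>I \<times> B \<rightarrow>\<^sub>E {..<2 * m}.
    real (card {x\<in>Pow {..<2 * m}. (\<exists>f\<in>K. \<forall>a\<in>I. \<sigma> (a, f a) \<in> x) \<noteq> (m < card x)}) \<le>
      (9 / 50 + 1 / t) * 4 ^ m"
proof -
  define N where "N = 2 * m"
  define \<Omega> where "\<Omega> = (I \<times> B \<rightarrow>\<^sub>E {..<N})"
  define c where "c = real (card \<Omega>)"
  define acc where "acc \<sigma> x \<longleftrightarrow> (\<exists>f\<in>K. \<forall>a\<in>I. \<sigma> (a, f a) \<in> x)" for \<sigma> :: "'a \<times> 'b \<Rightarrow> nat" and x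
  define err where "err x = real (card {\<sigma>\<in>\<Omega>. acc \<sigma> x \<noteq> (m < card x)})" for x
  \<comment> \<open>The value 40 balances two needs: \<open>800 * t \<le> n\<close> gives
    \<open>m * \<delta> \<le> t / 20\<close>, so the window is narrow, and Bernoulli gives
    \<open>41 \<le> (1 + \<delta>) ^ n\<close>.\<close>
  define \<delta> where "\<delta> = 40 / real n"
  have m: "0 < m" and N: "0 < N" using t by (simp_all add: N_def)
  have n0: "0 < n" "800 \<le> n" using n(2) t(1) by auto
  have \<delta>: "0 < \<delta>" "\<delta> < 1" using n0 by (auto simp: \<delta>_def field_simps)
  have "m * \<delta> \<le> t / 20"
  proof -
    have "40 * real m \<le> real t / 20 * n"
    proof -
      have "real (800 * t) \<le> real n" using n(2) by (rule of_nat_mono)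
      then have "real t * (800 * real t) \<le> real t * real n" by (intro mult_left_mono) auto
      then show ?thesis using t by (simp add: power2_eq_square)
    qed
    then show ?thesis using n0 by (simp add: \<delta>_def field_simps)
  qed
  have pow41: "41 \<le> (1 + \<delta>) ^ n"
    using linear_plus_1_le_power[of \<delta> n] \<delta> n0 by (simp add: \<delta>_def add.commute)
  have pow41': "(1 - \<delta>) ^ n \<le> 1 / 41"
  proof -
    have "(1 - \<delta>) ^ n * 41 \<le> (1 - \<delta>) ^ n * (1 + \<delta>) ^ n"
      using pow41 \<delta> by (intro mult_left_mono) auto
    also have "\<dots> = ((1 - \<delta>) * (1 + \<delta>)) ^ n" by (simp add: power_mult_distrib)
    also have "\<dots> \<le> 1" using \<delta> by (intro power_le_one) (auto simp: algebra_simps intro: mult_le_one)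
    finally show ?thesis by simp
  qed
  have fin\<Omega>: "finite \<Omega>" using fin by (simp add: \<Omega>_def finite_PiE)
  have "\<Omega> \<noteq> {}" using N by (auto simp: \<Omega>_def PiE_eq_empty_iff)
  then have c: "c > 0" using fin\<Omega> by (simp add: c_def card_gt_0_iff)
  have Kne: "K \<noteq> {}" using cK(1) by auto
  have cKr: "2 ^ n \<le> real (card K)" "real (card K) \<le> 2 * 2 ^ n"
    using of_nat_mono[OF cK(1), where 'a = real] of_nat_mono[OF less_imp_le[OF cK(2)], where 'a = real] by simp_all
  \<comment> \<open>Above the window at least 41 words survive on average, and the second moment
    bounds the failure by 20/19 - 1 + 1/41 < 2/25.\<close>
  have err_high: "err x \<le> 2 / 25 * c" if x: "x \<subseteq> {..<N}" and w: "m + t / 20 \<le> real (card x)" for x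
  proof -
    define p where "p = real (card x) / N"
    have mw: "m < card x" using w t(1) by linarith
    then have "x \<noteq> {}" by auto
    have ph: "(1 + \<delta>) / 2 \<le> p"
      using w \<open>m * \<delta> \<le> t / 20\<close> m by (simp add: p_def N_def field_simps)
    have "41 \<le> 2 ^ n * ((1 + \<delta>) / 2) ^ n" using pow41 by (simp add: power_divide)
    also have "\<dots> \<le> card K * p ^ n" using cKr(1) ph \<delta> by (intro mult_mono power_mono) auto
    finally have "41 \<le> card K * p ^ n" .
    then have i1: "1 / (card K * p ^ n) \<le> 1 / 41" by (intro divide_left_mono) auto
    have "(N / real (card x) - 1) / q \<le> 1 / q" 
      using mw q by (intro divide_right_mono) (auto simp: N_def field_simps)
    moreover have "0 \<le> (N / real (card x) - 1) / q"
    proof -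
      have "card x \<le> N" using card_mono[OF _ x] by simp
      then show ?thesis using mw q by (intro divide_nonneg_pos) (auto simp: field_simps)
    qed
    ultimately have "(1 + (N / card x - 1) / q) ^ n \<le> (1 + 1 / q) ^ n"
      by (intro power_mono) auto
    also have "\<dots> \<le> 20 / 19" using one_plus_inverse_power_le q by blast
    finally have i2: "(1 + (N / card x - 1) / q) ^ n \<le> 20 / 19" .
    have "{\<sigma>\<in>\<Omega>. acc \<sigma> x \<noteq> (m < card x)} = {\<sigma>\<in>\<Omega>. \<not> (\<exists>f\<in>K. \<forall>a\<in>I. \<sigma> (a, f a) \<in> x)}"
      using mw by (auto simp: acc_def)
    moreover have "real (card {\<sigma>\<in>I \<times> B \<rightarrow>\<^sub>E {..<N}. \<not> (\<exists>f\<in>K. \<forall>a\<in>I. \<sigma> (a, f a) \<in> x)}) \<le>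
        ((1 + (N / card x - 1) / q) ^ card I - 1 + 1 / (card K * (card x / N) ^ card I)) *
          card (I \<times> B \<rightarrow>\<^sub>E {..<N})"
      by (rule card_no_word_survives_le[OF fin _ x N \<open>x \<noteq> {}\<close> q(1) Kne]) (fact K mds)+
    ultimately have "err x \<le> ((1 + (N / card x - 1) / q) ^ n - 1 + 1 / (card K * p ^ n)) * c"
      unfolding err_def \<Omega>_def c_def p_def n(1) by simp
    also have "\<dots> \<le> (20 / 19 - 1 + 1 / 41) * c"
      using i1 i2 c by (intro mult_right_mono add_mono diff_right_mono) auto
    also have "\<dots> \<le> 2 / 25 * c" using c by (intro mult_right_mono) auto
    finally show ?thesis .
  qed
  \<comment> \<open>Below the window the expected number of survivors is at most
    \<open>2 * (1 - \<delta>) ^ n\<close>, hence at most 2/41.\<close>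
  have err_low: "err x \<le> 2 / 25 * c" if x: "x \<subseteq> {..<N}" and w: "real (card x) \<le> m - t / 20" for x
  proof -
    define p where "p = real (card x) / N"
    have mw: "\<not> m < card x" using w t(1) by linarith
    have pl: "p \<le> (1 - \<delta>) / 2"
      using w \<open>m * \<delta> \<le> t / 20\<close> m by (simp add: p_def N_def field_simps)
    have "{\<sigma>\<in>\<Omega>. acc \<sigma> x \<noteq> (m < card x)} = {\<sigma>\<in>\<Omega>. \<exists>f\<in>K. \<forall>a\<in>I. \<sigma> (a, f a) \<in> x}"
      using mw by (auto simp: acc_def)
    then have "err x \<le> card K * p ^ n * c"
      using card_word_survives_le[OF fin _ x N] K unfolding err_def \<Omega>_def c_def p_def n(1) by simp
    also have "\<dots> \<le> (2 * 2 ^ n) * ((1 - \<delta>) / 2) ^ n * c"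
      using cKr(2) pl c \<delta> by (intro mult_mono power_mono) (auto simp: p_def)
    also have "\<dots> = 2 * (1 - \<delta>) ^ n * c" by (simp add: power_divide)
    also have "\<dots> \<le> 2 * (1 / 41) * c" using pow41' c by (intro mult_right_mono mult_left_mono) auto
    also have "\<dots> \<le> 2 / 25 * c" using c by (intro mult_right_mono) auto
    finally show ?thesis .
  qed
  \<comment> \<open>Sizes are integers, so lying outside \<open>W\<close> means deviating from
    \<open>m\<close> by at least \<open>t / 20\<close> despite the rounding; \<open>W\<close>
    comprises at most \<open>t / 10 + 1\<close> layers.\<close>
  define W where "W = {x. x \<subseteq> {..<N} \<and> card x \<in> {m - t div 20..m + t div 20}}"
  have cP: "real (card (Pow {..<N})) = 4 ^ m" by (simp add: card_Pow N_def power_mult)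
  have cW: "real (card W) \<le> (1 / 10 + 1 / t) * 4 ^ m"
  proof -
    have "card W \<le> card {m - t div 20..m + t div 20} * ((2 * m) choose m)"
      unfolding W_def by (rule card_subsets_with_sizes_le) (simp_all add: N_def)
    then have "real (card W) \<le> real (card {m - t div 20..m + t div 20}) * real ((2 * m) choose m)"
      unfolding of_nat_mult[symmetric] by (rule of_nat_mono)
    also have "\<dots> \<le> (t / 10 + 1) * (4 ^ m / t)"
    proof (rule mult_mono)
      have "real (t div 20) \<le> t / 20" by linarith
      then show "real (card {m - t div 20..m + t div 20}) \<le> t / 10 + 1" by simp
      show "real ((2 * m) choose m) \<le> 4 ^ m / t"
        using central_binomial_square_le[OF t(2)] t(1) by (simp add: field_simps)
    qed auto
    also have "\<dots> = (1 / 10 + 1 / t) * 4 ^ m" using t(1) by (simp add: field_simps)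
    finally show ?thesis .
  qed
  have err_all: "err x \<le> 2 / 25 * c + (if x \<in> W then c else 0)" if x: "x \<in> Pow {..<N}" for x
  proof (cases "x \<in> W")
    case True
    have "card {\<sigma>\<in>\<Omega>. acc \<sigma> x \<noteq> (m < card x)} \<le> card \<Omega>" using fin\<Omega> by (intro card_mono) auto
    then have "err x \<le> c" unfolding err_def c_def by (rule of_nat_mono)
    then show ?thesis using True c by simp
  next
    case False
    then have "card x < m - t div 20 \<or> m + t div 20 < card x" using x by (auto simp: W_def)
    then have "err x \<le> 2 / 25 * c"
    proof
      assume "m + t div 20 < card x"
      then have "m + t / 20 \<le> real (card x)" by linarith
      then show ?thesis using err_high x by auto
    next
      assume "card x < m - t div 20"
      then have "real (card x) \<le> m - t / 20" by linarith
      then show ?thesis using err_low x by auto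
    qed
    then show ?thesis using False by simp
  qed
  have WP: "W \<subseteq> Pow {..<N}" by (auto simp: W_def)
  have "(\<Sum>\<sigma>\<in>\<Omega>. real (card {x\<in>Pow {..<N}. acc \<sigma> x \<noteq> (m < card x)})) =
      (\<Sum>\<sigma>\<in>\<Omega>. \<Sum>x\<in>Pow {..<N}. if acc \<sigma> x \<noteq> (m < card x) then 1 else 0)"
    by (simp add: sum.If_cases Int_def)
  also have "\<dots> = (\<Sum>x\<in>Pow {..<N}. \<Sum>\<sigma>\<in>\<Omega>. if acc \<sigma> x \<noteq> (m < card x) then 1 else 0)"
    by (rule sum.swap)
  also have "\<dots> = (\<Sum>x\<in>Pow {..<N}. err x)"
    using fin\<Omega> by (simp add: sum.If_cases Int_def err_def)
  also have "\<dots> \<le> (\<Sum>x\<in>Pow {..<N}. 2 / 25 * c + (if x \<in> W then c else 0))"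
    by (intro sum_mono err_all)
  also have "\<dots> = 2 / 25 * c * 4 ^ m + real (card W) * c"
    using WP cP by (simp add: sum.distrib sum.If_cases Int_absorb1)
  also have "\<dots> \<le> 2 / 25 * c * 4 ^ m + (1 / 10 + 1 / t) * 4 ^ m * c"
    using cW c by (intro add_left_mono mult_right_mono) auto
  also have "\<dots> = (\<Sum>\<sigma>\<in>\<Omega>. (9 / 50 + 1 / t) * 4 ^ m)" by (simp add: c_def algebra_simps)
  finally have tot: "(\<Sum>\<sigma>\<in>\<Omega>. real (card {x\<in>Pow {..<N}. acc \<sigma> x \<noteq> (m < card x)})) \<le>
      (\<Sum>\<sigma>\<in>\<Omega>. (9 / 50 + 1 / t) * 4 ^ m)" .
  have "\<exists>\<sigma>\<in>\<Omega>. real (card {x\<in>Pow {..<N}. acc \<sigma> x \<noteq> (m < card x)}) \<le> (9 / 50 + 1 / t) * 4 ^ m"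
  proof (rule ccontr)
    assume "\<not> ?thesis"
    then have "(\<Sum>\<sigma>\<in>\<Omega>. (9 / 50 + 1 / t) * 4 ^ m) <
        (\<Sum>\<sigma>\<in>\<Omega>. real (card {x\<in>Pow {..<N}. acc \<sigma> x \<noteq> (m < card x)}))"
      using fin\<Omega> \<open>\<Omega> \<noteq> {}\<close> by (intro sum_strict_mono) auto
    then show False using tot by linarith
  qed
  then show ?thesis unfolding \<Omega>_def acc_def N_def .
qed

section \<open>Andreev's problem\<close>

text \<open>Leading zeros pad a polynomial to length \<open>Suc d\<close> and
  \<open>normalize\<close> strips them; neither changes the evaluation.\<close>

lemma andreev_iff_rs_code:
  assumes "field F" "r * real (order F) = real d"
  shows "andreev F r S \<longleftrightarrow> (\<exists>f\<in>rs_code F (Suc d). \<forall>a\<in>carrier F. (a, f a) \<in> S)"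
proof -
  interpret field F by fact
  show ?thesis
  proof
    assume "andreev F r S"
    then obtain P where P: "polynomial\<^bsub>F\<^esub> (carrier F) P" "length P \<le> Suc d"
        "\<forall>a\<in>carrier F. (a, eval P a) \<in> S"
      using assms(2) by (auto simp: andreev_def)
    have car: "set P \<subseteq> carrier F" using polynomial_incl[OF P(1)] .
    define p where "p = replicate (Suc d - length P) \<zero>\<^bsub>F\<^esub> @ P"
    have "set p \<subseteq> carrier F" "length p = Suc d" using car P(2) by (auto simp: p_def)
    moreover have "eval p a = eval P a" if "a \<in> carrier F" for a
      unfolding p_def using eval_replicate[OF car that] .
    ultimately show "\<exists>f\<in>rs_code F (Suc d). \<forall>a\<in>carrier F. (a, f a) \<in> S"
      using P(3) by (intro bexI[of _ "restrict (eval p) (carrier F)"]) (auto simp: rs_code_def)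
  next
    assume "\<exists>f\<in>rs_code F (Suc d). \<forall>a\<in>carrier F. (a, f a) \<in> S"
    then obtain p where p: "set p \<subseteq> carrier F" "length p = Suc d"
        "\<forall>a\<in>carrier F. (a, eval p a) \<in> S" by (auto simp: rs_code_def)
    have "length (normalize p) - 1 \<le> d" using normalize_length_le[of p] p(2) by linarith
    then have "real (length (normalize p) - 1) \<le> r * real (order F)" using assms(2) by simp
    then show "andreev F r S"
      unfolding andreev_def using normalize_gives_polynomial[OF p(1)] eval_normalize[OF p(1)] p(3)
      by (intro exI[of _ "normalize p"]) auto
  qed
qed

text \<open>\<open>S x\<close> has only the zero point in the columns of \<open>J\<close>, the
  points sent into \<open>x\<close> by \<open>\<sigma>\<close> in the columns of \<open>I\<close>,
  and all points elsewhere. It contains a word exactly if a word of the subcode \<open>K\<close>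
  vanishing on \<open>J\<close> survives, and each input bit is a constant or one bit of
  \<open>x\<close>, so the circuit is turned into one close to majority.\<close>

lemma andreev_circuit_bound:
  fixes F :: "'a ring"
  assumes F: "field F" "finite (carrier F)" and d: "r * real (order F) = real d" "Suc d \<le> order F"
    and k: "k \<le> Suc d" "2 ^ n \<le> order F ^ k" "order F ^ k < 2 ^ (n + 1)"
    and n: "20 * n \<le> order F" "n + (Suc d - k) \<le> order F"
    and C: "computes C (carrier F \<times> carrier F) (andreev F r)" "circuit_depth C \<le> h"
      "circuit_size C \<le> 2 ^ s" "2 \<le> h"
  shows "n \<le> 23200 * (s + 5) ^ (h - 1)"
proof -
  interpret field F by fact
  define t where "t = n div 800"
  define m where "m = t\<^sup>2"
  define q where "q = order F"
  define V where "V = carrier F \<times> carrier F"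
  have cF: "card (carrier F) = q" by (simp add: q_def order_def)
  have q0: "0 < q" using d(2) by (simp add: q_def)
  have bound: "t \<le> 28 * (s + 5) ^ (h - 1)" if t0: "0 < t"
  proof -
    obtain J where J: "J \<subseteq> carrier F" "card J = Suc d - k"
      using obtain_subset_with_card_n[of "Suc d - k" "carrier F"] n(2) cF by (auto simp: q_def)
    have finJ: "finite J" using finite_subset[OF J(1) F(2)] .
    have "n \<le> card (carrier F - J)" using n(2) J cF by (simp add: card_Diff_subset[OF finJ] q_def)
    then obtain I where I: "I \<subseteq> carrier F - J" "card I = n"
      using obtain_subset_with_card_n by metis
    have finI: "finite I" using I(1) F(2) finite_subset by blast
    define R where "R = rs_code F (Suc d)"
    define K where "K = {f\<in>R. \<forall>a\<in>J. f a = \<zero>\<^bsub>F\<^esub>}"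
    have Rsub: "R \<subseteq> carrier F \<rightarrow>\<^sub>E carrier F" unfolding R_def by (rule rs_code_subset)
    have Rbij: "bij_betw (\<lambda>f. restrict f T) R (T \<rightarrow>\<^sub>E carrier F)"
      if "T \<subseteq> carrier F" "card T = Suc d" for T
      unfolding R_def by (rule rs_code_bij[OF F(2) that])
    have finR: "finite R" using finite_subset[OF Rsub] F(2) by (simp add: finite_PiE)
    have finK: "finite K" using finR by (simp add: K_def)
    have prescribed: "card {f\<in>R. \<forall>a\<in>U. f a = v a} = q ^ (Suc d - card U)"
      if "U \<subseteq> carrier F" "card U \<le> Suc d" "v \<in> U \<rightarrow> carrier F" for U v
      using card_code_prescribed[OF F(2) F(2) Rsub Rbij _ that] d(2) cF by (simp add: q_def)
    \<comment> \<open>Fixing \<open>Suc d - k\<close> coordinates leaves dimension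
      \<open>k\<close>.\<close>
    have cK: "card K = q ^ k"
      unfolding K_def using prescribed[OF J(1), of "\<lambda>_. \<zero>\<^bsub>F\<^esub>"] J(2) k(1) by simp
    have Kval: "f a \<in> carrier F" if "f \<in> K" "a \<in> I" for f a
      using that Rsub I(1) by (auto simp: K_def)
    have mds: "real (card {g\<in>K. \<forall>a\<in>T. g a = f a}) \<le> card K / real q ^ card T + 1"
      if f: "f \<in> K" and T: "T \<subseteq> I" for f T
    proof -
      have finT: "finite T" using finite_subset[OF T finI] .
      have JT: "J \<union> T \<subseteq> carrier F" using J I T by auto
      have cJT: "card (J \<union> T) = Suc d - k + card T"
        using card_Un_disjoint[OF finJ finT] T I(1) J(2) by auto
      have eq: "{g\<in>K. \<forall>a\<in>T. g a = f a} = {g\<in>R. \<forall>a\<in>J \<union> T. g a = f a}"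
        using f by (auto simp: K_def)
      \<comment> \<open>As long as \<open>J \<union> T\<close> has at most \<open>Suc d\<close>
        coordinates, exactly \<open>q ^ (k - card T)\<close> words agree with \<open>f\<close>;
        beyond that at most one does, which is the reason for the summand 1.\<close>
      show ?thesis
      proof (cases "card (J \<union> T) \<le> Suc d")
        case True
        have "f \<in> carrier F \<rightarrow>\<^sub>E carrier F" using f Rsub by (auto simp: K_def)
        then have "f \<in> (J \<union> T) \<rightarrow> carrier F" using JT by (auto dest: PiE_mem)
        then have "card {g\<in>K. \<forall>a\<in>T. g a = f a} = q ^ (Suc d - card (J \<union> T))"
          unfolding eq by (rule prescribed[OF JT True])
        also have "Suc d - card (J \<union> T) = k - card T" using cJT k(1) by simp
        finally have "real (card {g\<in>K. \<forall>a\<in>T. g a = f a}) = real q ^ (k - card T)" by simp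
        moreover have "card T \<le> k" using cJT True k(1) by simp
        ultimately show ?thesis using q0 by (simp add: cK power_diff)
      next
        case False
        then have "card {g\<in>K. \<forall>a\<in>T. g a = f a} \<le> 1"
          unfolding eq using card_code_agreeing[OF F(2) F(2) Rsub Rbij JT] by simp
        then have "real (card {g\<in>K. \<forall>a\<in>T. g a = f a}) \<le> 1" by simp
        also have "\<dots> \<le> card K / real q ^ card T + 1" by simp
        finally show ?thesis .
      qed
    qed
    have "\<exists>\<sigma>\<in>I \<times> carrier F \<rightarrow>\<^sub>E {..<2 * m}.
        real (card {x\<in>Pow {..<2 * m}. (\<exists>f\<in>K. \<forall>a\<in>I. \<sigma> (a, f a) \<in> x) \<noteq> (m < card x)}) \<le>
          (9 / 50 + 1 / t) * 4 ^ m"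
    proof (rule exists_projection_to_majority[OF finI F(2) finK])
      show "20 * real n \<le> real q" using n(1) unfolding q_def by linarith
      show "800 * t \<le> n" by (simp add: t_def)
      show "2 ^ n \<le> card K" "card K < 2 ^ (n + 1)" using k by (simp_all add: cK q_def)
    qed (use q0 t0 I(2) m_def Kval mds in auto)
    then obtain \<sigma> where \<sigma>: "\<sigma> \<in> I \<times> carrier F \<rightarrow>\<^sub>E {..<2 * m}"
        "real (card {x\<in>Pow {..<2 * m}. (\<exists>f\<in>K. \<forall>a\<in>I. \<sigma> (a, f a) \<in> x) \<noteq> (m < card x)}) \<le>
          (9 / 50 + 1 / t) * 4 ^ m" by blast
    define S where "S x = {(a, b) \<in> V. (a \<in> J \<longrightarrow> b = \<zero>\<^bsub>F\<^esub>) \<and> (a \<in> I \<longrightarrow> \<sigma> (a, b) \<in> x)}" for x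
    have acc: "andreev F r (S x) \<longleftrightarrow> (\<exists>f\<in>K. \<forall>a\<in>I. \<sigma> (a, f a) \<in> x)" for x
    proof -
      have "(\<forall>a\<in>carrier F. (a, f a) \<in> S x) \<longleftrightarrow> (\<forall>a\<in>J. f a = \<zero>\<^bsub>F\<^esub>) \<and> (\<forall>a\<in>I. \<sigma> (a, f a) \<in> x)"
        if "f \<in> R" for f
        using that Rsub J(1) I(1) by (auto simp: S_def V_def)
      then show ?thesis unfolding andreev_iff_rs_code[OF F(1) d(1)] R_def[symmetric] K_def by blast
    qed
    have val: "circuit_val C (\<lambda>v. v \<in> S x) = (\<exists>f\<in>K. \<forall>a\<in>I. \<sigma> (a, f a) \<in> x)" for x
    proof -
      have "S x \<subseteq> V" by (auto simp: S_def)
      then show ?thesis using C(1) acc by (simp add: computes_def V_def)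
    qed
    have inputs: "f2_degree_le {..<2 * m} 1 (\<lambda>x. v \<in> S x)" if v: "v \<in> V" for v
    proof -
      obtain a b where ab: "v = (a, b)" "a \<in> carrier F" "b \<in> carrier F" using v by (auto simp: V_def)
      show ?thesis
      proof (cases "a \<in> I")
        case True
        then have "a \<notin> J" using I(1) by auto
        then have "(\<lambda>x. v \<in> S x) = (\<lambda>x. {\<sigma> (a, b)} \<subseteq> x)" using True ab by (auto simp: S_def V_def)
        moreover have "\<sigma> (a, b) \<in> {..<2 * m}" using PiE_mem[OF \<sigma>(1)] True ab(3) by blast
        ultimately show ?thesis using f2_monom[of "{\<sigma> (a, b)}" "{..<2 * m}" 1] by simp
      next
        case False
        then have "(\<lambda>x. v \<in> S x) = (\<lambda>x. a \<in> J \<longrightarrow> b = \<zero>\<^bsub>F\<^esub>)" using ab by (auto simp: S_def V_def)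
        then show ?thesis using f2_const by simp
      qed
    qed
    show ?thesis
    proof (rule circuit_majority_bound[OF t0 m_def C(4) inputs _ C(2,3)])
      show "circuit_over V C" using C(1) by (simp add: computes_def V_def)
      show "real (card {x\<in>Pow {..<2 * m}. circuit_val C (\<lambda>v. v \<in> S x) \<noteq> (m < card x)}) \<le>
          (9 / 50 + 1 / t) * 4 ^ m"
        unfolding val by (rule \<sigma>(2))
    qed
  qed
  \<comment> \<open>Rounding in \<open>n div 800\<close> costs at most 800, which this absorbs: 800
    * 28 + 800 = 23200. If \<open>t = 0\<close>, the bound on \<open>t\<close> is trivial.\<close>
  have L: "1 \<le> (s + 5) ^ (h - 1)" by simp
  have "n \<le> 800 * t + 800" unfolding t_def using div_mult_mod_eq[of n 800] mod_less_divisor[of 800 n] by linarith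
  moreover have "t \<le> 28 * (s + 5) ^ (h - 1)" using bound by (cases "0 < t") auto
  ultimately show ?thesis using L by linarith
qed

section \<open>Circuits with at most one gate\<close>

lemma odd_filter_imp_odd_count:
  assumes "finite G" "odd (length (filter (\<lambda>w. w \<in> G) ws))"
  shows "\<exists>v\<in>G. odd (count_list ws v)"
proof (rule ccontr)
  assume even: "\<not> ?thesis"
  have "length (filter (\<lambda>w. w \<in> G) ws) = (\<Sum>v\<in>G. count_list ws v)"
  proof (induction ws)
    case (Cons w ws)
    have "(\<Sum>v\<in>G. count_list (w # ws) v) = (\<Sum>v\<in>G. count_list ws v + (if v = w then 1 else 0))"
      by (intro sum.cong) auto
    then show ?case using Cons assms(1) by (simp add: sum.distrib)
  qed simp
  moreover have "even (\<Sum>v\<in>G. count_list ws v)" using even by (intro dvd_sum) auto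
  ultimately show False using assms(2) by simp
qed

text \<open>An accepted set meets every column, so the empty set and all singletons are rejected,
  while the disjoint graphs of the constants 0 and 1 are accepted. No input and no single gate
  behaves like this.\<close>

lemma andreev_circuit_size_ge_2:
  fixes F :: "'a ring"
  assumes F: "field F" "finite (carrier F)" and r: "0 \<le> r"
    and C: "computes C (carrier F \<times> carrier F) (andreev F r)"
  shows "2 \<le> circuit_size C"
proof (rule ccontr)
  assume "\<not> ?thesis"
  then have small: "length (gates C) \<le> 1" by (simp add: circuit_size_def)
  interpret field F by fact
  define V where "V = carrier F \<times> carrier F"
  define f where "f S = circuit_val C (\<lambda>v. v \<in> S)" for S
  have over: "circuit_over V C" using C by (simp add: computes_def V_def)
  have f: "f S = andreev F r S" if "S \<subseteq> V" for S using C that by (simp add: computes_def V_def f_def)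
  define G where "G b = (\<lambda>a. (a, b)) ` carrier F" for b :: 'a
  have finG: "finite (G b)" for b using F(2) by (simp add: G_def)
  have const: "f (G b)" if b: "b \<in> carrier F" for b
  proof -
    have "polynomial\<^bsub>F\<^esub> (carrier F) (normalize [b])" using b by (intro normalize_gives_polynomial) simp
    moreover have "real (length (normalize [b]) - 1) \<le> r * real (order F)" using r by simp
    moreover have "(a, eval (normalize [b]) a) \<in> G b" if "a \<in> carrier F" for a
      using eval_normalize[of "[b]" a] that b by (simp add: G_def)
    ultimately have "andreev F r (G b)" unfolding andreev_def by blast
    moreover have "G b \<subseteq> V" using b by (auto simp: G_def V_def)
    ultimately show ?thesis using f by simp
  qed
  have column: "\<exists>b. (a, b) \<in> S" if "S \<subseteq> V" "f S" "a \<in> carrier F" for S a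
    using that f[of S] by (auto simp: andreev_def)
  have empty: "\<not> f {}" using column[of "{}" "\<zero>\<^bsub>F\<^esub>"] by auto
  have single: "\<not> f {v}" if "v \<in> V" for v
    using column[of "{v}" "\<zero>\<^bsub>F\<^esub>"] column[of "{v}" "\<one>\<^bsub>F\<^esub>"] that by auto
  have G01: "G \<zero>\<^bsub>F\<^esub> \<inter> G \<one>\<^bsub>F\<^esub> = {}" by (auto simp: G_def)
  show False
  proof (cases "output_wire C")
    case (Input v)
    then have "v \<in> V" "f {v}"
      using over by (auto simp: circuit_over_def wires_available_def f_def circuit_val_def)
    then show ?thesis using single by blast
  next
    case (Gate i)
    then have i: "i = 0" "length (gates C) = 1"
      using over small by (auto simp: circuit_over_def wires_available_def)
    then obtain g where g: "gates C = [g]" by (auto simp: length_Suc_conv)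
    have inp: "gate_inputs g \<subseteq> Input ` V"
      using over g by (auto simp: circuit_over_def wires_available_def)
    have val: "f S = gate_val (\<lambda>v. v \<in> S) [] g" for S
      using Gate i g by (simp add: f_def circuit_val_def)
    show ?thesis
    proof (cases g)
      case (And ws)
      \<comment> \<open>The empty conjunction accepts the empty set; any other one has an input that
        would have to lie in both disjoint graphs.\<close>
      have "ws \<noteq> []" using val[of "{}"] empty And by auto
      then obtain v where "Input v \<in> set ws" using inp And by (cases ws) auto
      then have "v \<in> G \<zero>\<^bsub>F\<^esub>" "v \<in> G \<one>\<^bsub>F\<^esub>"
        using const[of "\<zero>\<^bsub>F\<^esub>"] const[of "\<one>\<^bsub>F\<^esub>"] val And by auto
      then show ?thesis using G01 by auto
    next
      case (Or ws)
      then obtain w where w: "w \<in> set ws" "wire_val (\<lambda>v. v \<in> G \<zero>\<^bsub>F\<^esub>) [] w"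
        using const[of "\<zero>\<^bsub>F\<^esub>"] val by auto
      then obtain v where v: "w = Input v" "v \<in> V" using inp Or by auto
      then have "f {v}" using val[of "{v}"] Or w(1) by (auto intro!: bexI[of _ "Input v"])
      then show ?thesis using single v by blast
    next
      case (Xor ws)
      have "wire_val (\<lambda>v. v \<in> S) [] w \<longleftrightarrow> w \<in> Input ` S" if "w \<in> set ws" for w S
        using that inp Xor by auto
      then have f_eq: "f S = odd (length (filter (\<lambda>w. w \<in> Input ` S) ws))" for S
        using val Xor by (simp cong: filter_cong)
      \<comment> \<open>Wires may be repeated, so only inputs of odd multiplicity affect the parity;
        the singleton of such an input is accepted.\<close>
      obtain v where v: "odd (count_list ws (Input v))"
        using odd_filter_imp_odd_count[of "Input ` G \<zero>\<^bsub>F\<^esub>" ws] f_eq const[of "\<zero>\<^bsub>F\<^esub>"] finG by auto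
      then have "Input v \<in> set ws" by (metis count_list_0_iff even_zero)
      then have "v \<in> V" using inp Xor by auto
      moreover have "f {v}" 
        using v f_eq[of "{v}"] by (simp add: count_list_eq_length_filter eq_commute[of _ "Input v"])
      ultimately show ?thesis using single by blast
    next
      case (Not w)
      then have "f {}" using val inp by auto
      then show ?thesis using empty by blast
    qed
  qed
qed

section \<open>Asymptotics and choice of parameters\<close>

lemma eventually_size_conditions:
  fixes A \<beta> \<rho> B :: real
  assumes "0 < \<beta>" "0 < \<rho>" "\<rho> < 1" "0 < A"
  shows "\<forall>\<^sub>F x in at_top. A * x powr (\<rho>\<^sup>2) < \<beta> * x - log 2 x - 1 \<and> B \<le> ln x \<and> 1 \<le> \<beta> * x / log 2 x"
proof -
  \<comment> \<open>This makes \<open>x powr (\<rho>\<^sup>2)\<close> sublinear, so the linear term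
    wins for every \<open>A\<close>.\<close>
  have e: "\<rho>\<^sup>2 < 1" using assms by (simp add: power_less_one_iff abs_square_less_1)
  define \<epsilon> where "\<epsilon> = \<rho>\<^sup>2"
  have "0 < \<epsilon>" "\<epsilon> < 1" using e assms by (simp_all add: \<epsilon>_def)
  with assms(4) have "((\<lambda>x. A * x powr \<epsilon> / x + log 2 x / x + 1 / x) \<longlongrightarrow> 0) at_top" by real_asymp
  then have "\<forall>\<^sub>F x in at_top. A * x powr \<epsilon> / x + log 2 x / x + 1 / x < \<beta>"
    using assms(1) by (rule order_tendstoD)
  then have "\<forall>\<^sub>F x in at_top. A * x powr \<epsilon> < \<beta> * x - log 2 x - 1"
    using eventually_gt_at_top[of 0]
  proof eventually_elim
    case (elim x)
    then show ?case by (simp add: field_simps)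
  qed
  moreover have "\<forall>\<^sub>F x in at_top. B \<le> ln x"
    using filterlim_at_top[THEN iffD1, OF ln_at_top] by blast
  moreover have "\<forall>\<^sub>F x in at_top. 1 \<le> \<beta> * x / log 2 x"
    using assms(1) by real_asymp
  ultimately show ?thesis unfolding \<epsilon>_def by eventually_elim simp
qed

text \<open>The number e is at most 4, that is, \<open>1 \<le> 2 * ln 2\<close>.\<close>

lemma exp_le_two_power:
  assumes "0 \<le> (E :: real)"
  shows "exp E \<le> 2 ^ nat \<lceil>2 * E\<rceil>"
proof -
  have "exp 1 \<le> (4::real)" using exp_le by linarith
  then have "ln (exp 1) \<le> ln (4::real)" by (subst ln_le_cancel_iff) auto
  then have "1 \<le> 2 * ln (2::real)" using ln_realpow[of 2 2] by simp
  then have "E * 1 \<le> E * (2 * ln 2)" using assms by (intro mult_left_mono) auto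
  then have "exp E \<le> exp (2 * E * ln 2)" by simp
  also have "\<dots> = 2 powr (2 * E)" by (simp add: powr_def)
  also have "\<dots> \<le> 2 powr real (nat \<lceil>2 * E\<rceil>)" by (intro powr_mono) (auto simp: real_nat_ceiling_ge)
  finally show ?thesis by (simp add: powr_realpow)
qed

theorem mainTheorem1:
  shows "\<exists>c::real. \<exists>k::nat. c > 0 \<and>
    (\<forall>(h::nat) (\<rho>::real). 2 \<le> h \<and> \<rho> < 1 \<longrightarrow>
      (\<exists>q\<^sub>0::nat. \<forall>(q::nat) (r::real) (F::'a ring) (C::('a \<times> 'a) circuit).
        primepow q \<and> q \<ge> q\<^sub>0 \<and> 0 < r \<and> r \<le> \<rho> \<and> r * real q \<in> \<int> \<and>
        field F \<and> finite (carrier F) \<and> order F = q \<and>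
        computes C (carrier F \<times> carrier F) (andreev F r) \<and> circuit_depth C \<le> h \<longrightarrow>
        real (circuit_size C) \<ge>
          exp (c * (real h * real q powr (r\<^sup>2 / (real h - 1))) / ln (real q) ^ k)))"
proof (rule exI[of _ 1], rule exI[of _ 1], intro conjI allI impI)
  \<comment> \<open>The witnesses are \<open>c = 1\<close> and a single factor \<open>ln q\<close>;
    everything that depends on \<open>h\<close> and \<open>\<rho>\<close> goes into the threshold
    for \<open>q\<close>.\<close>
  fix h :: nat and \<rho> :: real
  assume "2 \<le> h \<and> \<rho> < 1"
  then have h: "2 \<le> h" and \<rho>1: "\<rho> < 1" by auto
  show "\<exists>q\<^sub>0::nat. \<forall>(q::nat) (r::real) (F::'a ring) (C::('a \<times> 'a) circuit).
        primepow q \<and> q \<ge> q\<^sub>0 \<and> 0 < r \<and> r \<le> \<rho> \<and> r * real q \<in> \<int> \<and>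
        field F \<and> finite (carrier F) \<and> order F = q \<and>
        computes C (carrier F \<times> carrier F) (andreev F r) \<and> circuit_depth C \<le> h \<longrightarrow>
        real (circuit_size C) \<ge>
          exp (1 * (real h * real q powr (r\<^sup>2 / (real h - 1))) / ln (real q) ^ 1)"
  proof (cases "0 < \<rho>")
    case False
    then show ?thesis by (intro exI[of _ 0]) auto
  next
    case True
    \<comment> \<open>The bound 1/20 will give \<open>20 * n \<le> q\<close>, and
      \<open>1 - \<rho>\<close> leaves room for \<open>n\<close> random columns beside the
      \<open>Suc d - k\<close> fixed ones.\<close>
    define \<beta> where "\<beta> = min (1 / 20) (1 - \<rho>)"
    define A where "A = 23200 * real (2 * h + 6) ^ (h - 1)"
    have \<beta>: "0 < \<beta>" "\<beta> \<le> 1 / 20" "\<beta> \<le> 1 - \<rho>" using \<rho>1 unfolding \<beta>_def by linarith+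
    have A: "0 < A" by (simp add: A_def)
    obtain x0 where x0: "\<And>x. x0 \<le> x \<Longrightarrow> A * x powr (\<rho>\<^sup>2) < \<beta> * x - log 2 x - 1 \<and>
        6 * real h \<le> ln x \<and> 1 \<le> \<beta> * x / log 2 x"
      using eventually_size_conditions[OF \<beta>(1) True \<rho>1, of A "6 * real h"] A
      unfolding eventually_at_top_linorder by blast
    show ?thesis
    proof (intro exI[of _ "max 2 (nat \<lceil>x0\<rceil>)"] allI impI, elim conjE)
      fix q :: nat and r :: real and F :: "'a ring" and C :: "('a \<times> 'a) circuit"
      assume q: "max 2 (nat \<lceil>x0\<rceil>) \<le> q" and r: "0 < r" "r \<le> \<rho>" "r * real q \<in> \<int>"
        and F: "field F" "finite (carrier F)" "order F = q"
        and C: "computes C (carrier F \<times> carrier F) (andreev F r)" "circuit_depth C \<le> h"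
      define E where "E = real h * real q powr (r\<^sup>2 / (real h - 1)) / ln (real q)"
      have "x0 \<le> real q" using q by linarith
      from x0[OF this] have big: "A * real q powr (\<rho>\<^sup>2) < \<beta> * q - log 2 q - 1"
        and lnq: "6 * real h \<le> ln q" and bq: "1 \<le> \<beta> * q / log 2 q" by auto
      have q2: "2 \<le> q" using q by simp
      have lnq1: "1 \<le> ln (real q)" using lnq h by linarith
      have log2: "1 \<le> log 2 q" "ln q \<le> log 2 q"
      proof -
        show "1 \<le> log 2 q" using q2 by (simp add: le_log_iff)
        have "ln (2::real) \<le> 1" using ln_le_minus_one[of 2] by simp
        then show "ln q \<le> log 2 q"
          using lnq1 by (simp add: log_def field_simps mult_le_cancel_left1)
      qed
      obtain d where d: "r * real q = real d"
      proof -
        obtain z :: int where "r * real q = of_int z" using r(3) by (auto elim: Ints_cases)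
        moreover have "0 \<le> r * real q" using r by simp
        ultimately show ?thesis using that[of "nat z"] by simp
      qed
      have dq: "real d \<le> \<rho> * q" unfolding d[symmetric] using r q2 by (intro mult_right_mono) auto
      \<comment> \<open>With this choice \<open>q ^ k\<close> is 2 to the power
        \<open>\<beta> * q\<close>, up to rounding.\<close>
      define k where "k = nat \<lfloor>\<beta> * q / log 2 q\<rfloor>"
      have k1: "1 \<le> k" using bq by (simp add: k_def le_nat_floor)
      have kle: "real k \<le> \<beta> * q / log 2 q" using bq by (simp add: k_def)
      have kge: "\<beta> * q / log 2 q < real k + 1" using bq unfolding k_def by linarith
      have E0: "0 \<le> E" using lnq1 by (simp add: E_def)
      have "exp E \<le> real (circuit_size C)"
      proof (cases "k \<le> Suc d")
        case False
        \<comment> \<open>Here \<open>r\<close> is at most \<open>1 / ln q\<close>, so the power of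
          \<open>q\<close> in \<open>E\<close> is at most e. Then \<open>6 * h \<le> ln q\<close>
          gives \<open>E \<le> 1 / 2\<close>, and a circuit of two gates is already large
          enough.\<close>
        then have "r * real q < \<beta> * q / log 2 q" unfolding d using kle by linarith
        then have "r < \<beta> / log 2 q" using q2 by (simp add: field_simps)
        also have "\<dots> \<le> 1 / ln q" using log2 lnq1 \<beta> by (intro frac_le) auto
        finally have rl: "r \<le> 1 / ln q" by simp
        then have "r\<^sup>2 * ln q \<le> (1 / ln q)\<^sup>2 * ln q" using r lnq1 by (intro mult_right_mono power_mono) auto
        also have "\<dots> = 1 / ln q" using lnq1 by (simp add: power2_eq_square)
        also have "\<dots> \<le> 1" using lnq1 by simp
        finally have "r\<^sup>2 * ln q \<le> 1" .
        then have "r\<^sup>2 / (real h - 1) * ln q \<le> 1"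
          using h by (simp add: field_simps) 
        then have "real q powr (r\<^sup>2 / (real h - 1)) \<le> exp 1" using q2 by (simp add: powr_def)
        also have "\<dots> \<le> 3" by (rule exp_le)
        finally have "E \<le> real h * 3 / ln q"
          unfolding E_def using lnq1 by (intro divide_right_mono mult_left_mono) auto
        also have "\<dots> \<le> 1 / 2" using lnq lnq1 by (simp add: field_simps)
        finally have "E \<le> 1 / 2" .
        then have "exp E \<le> exp (1 / 2)" by simp
        also have "\<dots> \<le> 2" using exp_bound_half[of "1 / 2 :: real"] by simp
        also have "\<dots> \<le> real (circuit_size C)"
          using andreev_circuit_size_ge_2[OF F(1,2) _ C(1)] r(1) by simp
        finally show ?thesis .
      next
        case True
        have "1 \<le> q ^ k" using q2 by simp
        then obtain n where n: "2 ^ n \<le> q ^ k" "q ^ k < 2 ^ (n + 1)"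
          using ex_power_ivl1[of 2 "q ^ k"] by auto
        have nle: "real n \<le> k * log 2 q"
        proof -
          have "real (2 ^ n) \<le> real (q ^ k)" using n(1) by (rule of_nat_mono)
          then have "log 2 (2 ^ n) \<le> log 2 (real q ^ k)"
            using q2 by (subst log_le_cancel_iff) simp_all
          then show ?thesis using q2 by (simp add: log_nat_power)
        qed
        have nge: "k * log 2 q \<le> real n + 1"
        proof -
          have "real (q ^ k) \<le> real (2 ^ (n + 1))" using n(2) by (intro of_nat_mono) simp
          then have "log 2 (real q ^ k) \<le> log 2 (2 ^ (n + 1))"
            using q2 by (subst log_le_cancel_iff) simp_all
          moreover have "log 2 (2 ^ (n + 1)) = real (n + 1)" by (rule log_pow_cancel) simp_all
          moreover have "log 2 (real q ^ k) = k * log 2 q" using q2 by (simp add: log_nat_power)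
          ultimately show ?thesis by linarith
        qed
        have n\<beta>: "real n \<le> \<beta> * q"
        proof -
          have "k * log 2 q \<le> \<beta> * q" using kle log2 by (simp add: field_simps)
          then show ?thesis using nle by linarith
        qed
        \<comment> \<open>Rounding \<open>k\<close> down loses at most \<open>log 2 q\<close>, and
          rounding to a power of two loses at most 1.\<close>
        have n\<beta>': "\<beta> * q - log 2 q - 1 \<le> n"
        proof -
          have "\<beta> * q \<le> (k + 1) * log 2 q" using kge log2 by (simp add: field_simps)
          then show ?thesis using nge by (simp add: algebra_simps)
        qed
        show ?thesis
        proof (rule ccontr)
          assume "\<not> ?thesis"
          then have sm: "real (circuit_size C) \<le> exp E" by simp
          define s where "s = nat \<lceil>2 * E\<rceil>"
          have "real (circuit_size C) \<le> real (2 ^ s)"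
            using order_trans[OF sm exp_le_two_power[OF E0]] unfolding s_def of_nat_power by simp
          then have size: "circuit_size C \<le> 2 ^ s" by (simp only: of_nat_le_iff)
          have "n \<le> 23200 * (s + 5) ^ (h - 1)"
          proof (rule andreev_circuit_bound[OF F(1,2) _ _ True _ _ _ _ C size h])
            show "r * real (order F) = real d" using d F(3) by simp
            have "\<rho> * q < q" using \<rho>1 q2 by simp
            then show "Suc d \<le> order F" using dq F(3) by linarith
            show "2 ^ n \<le> order F ^ k" "order F ^ k < 2 ^ (n + 1)" using n F(3) by simp_all
            have "\<beta> * q \<le> 1 / 20 * q" using \<beta>(2) by (intro mult_right_mono) auto
            then show "20 * n \<le> order F" using n\<beta> F(3) by linarith
            have "\<beta> * q \<le> (1 - \<rho>) * q" using \<beta>(3) by (intro mult_right_mono) auto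
            then have "real n + real d \<le> q" using n\<beta> dq by (simp add: algebra_simps)
            \<comment> \<open>\<open>1 \<le> k\<close> removes the extra 1 of
              \<open>Suc d\<close>.\<close>
            then show "n + (Suc d - k) \<le> order F" using k1 F(3) by linarith
          qed
          then have "real n \<le> real (23200 * (s + 5) ^ (h - 1))" by (rule of_nat_mono)
          also have "\<dots> = 23200 * real (s + 5) ^ (h - 1)" by simp
          also have "\<dots> \<le> 23200 * (real (2 * h + 6) * real q powr (\<rho>\<^sup>2 / (real h - 1))) ^ (h - 1)"
          proof (intro mult_left_mono power_mono)
            let ?Q = "real q powr (\<rho>\<^sup>2 / (real h - 1))"
            have "r\<^sup>2 / (real h - 1) \<le> \<rho>\<^sup>2 / (real h - 1)"
              using r h by (intro divide_right_mono power_mono) auto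
            then have "real q powr (r\<^sup>2 / (real h - 1)) \<le> ?Q" using q2 by (intro powr_mono) auto
            then have "E \<le> real h * ?Q / 1"
              unfolding E_def using lnq1 by (intro frac_le mult_left_mono) auto
            moreover have "1 \<le> ?Q" using q2 h by (intro ge_one_powr_ge_zero) auto
            moreover have "real s \<le> 2 * E + 1" using E0 unfolding s_def by linarith
            ultimately have "real (s + 5) \<le> 2 * (real h * ?Q) + 6 * ?Q" by simp
            then show "real (s + 5) \<le> real (2 * h + 6) * ?Q" by (simp add: algebra_simps)
          qed auto
          also have "\<dots> = A * (real q powr (\<rho>\<^sup>2 / (real h - 1))) ^ (h - 1)"
            by (simp add: A_def power_mult_distrib)
          \<comment> \<open>The power \<open>h - 1\<close> cancels the denominator in the exponent.
            The resulting bound on \<open>n\<close> is sublinear in \<open>q\<close>, whereas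
            \<open>n\<close> is close to \<open>\<beta> * q\<close>.\<close>
          also have "(real q powr (\<rho>\<^sup>2 / (real h - 1))) ^ (h - 1) = real q powr (\<rho>\<^sup>2)"
            using h q2 by (simp add: powr_power of_nat_diff)
          finally show False using big n\<beta>' by linarith
        qed
      qed
      then show "real (circuit_size C) \<ge>
          exp (1 * (real h * real q powr (r\<^sup>2 / (real h - 1))) / ln (real q) ^ 1)"
        by (simp add: E_def)
    qed
  qed
qed simp

end
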